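(* Let $\varepsilon>0$ be sufficiently small and assume $n\in\Omega\left(\exp\left((1/\varepsilon)^{O(1)}\right)\right)$ is sufficiently large. For any $r\in\Omega(\varepsilon^{-1}\log(\varepsilon^{-1}))\cap O(n^{1/3})$, there exists an algorithm that, for the problem of maximizing a monotone submodular function $f$ under a matroid constraint $\mathcal{I}(\mathcal{M})$ with rank $r$ given only the noisy value oracle $\tilde f$ (and a membership oracle for $\mathcal{I}(\mathcal{M})$), returns a $\left(\frac12\left(1-\frac1e\right)-O(\varepsilon)\right)$-approximation with probability at least $1-O(\varepsilon^4)$, using at most $O\left(r^2\log^2 r\cdot n^{3/2}\varepsilon^{-1}\max\{r,\log n\}\right)$ queries to $\tilde f$.
   Context: $N$ is a ground set with $|N|=n$. $f:2^N\to\mathbb{R}_{\ge0}$ is monotone, submodular, $f(\varnothing)=0$. A matroid $\mathcal{M}=(N,\mathcal{I}(\mathcal{M}))$ has independent sets $\mathcal{I}(\mathcal{M})$ satisfying: $\varnothing\in\mathcal{I}(\mathcal{M})$; subsets of independent sets are independent; if $I_1,I_2\in\mathcal{I}(\mathcal{M})$ with $|I_1|<|I_2|$ there is $e\in I_2\setminus I_1$ with $I_1\cup\{e\}\in\mathcal{I}(\mathcal{M})$; its rank is the maximum size of an independent set. It is assumed all singletons are independent. A noise distribution $\mathcal{D}$ has a generalized exponential tail if there is $x_0$ such that for $x>x_0$ its density is $e^{-\sum_ic_ix^{\gamma_i}}$ with $\gamma_0\ge\gamma_1\ge\cdots$, $\gamma_0\ge1$, $c_0>0$; for bounded support it is only required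 that $\mathcal{D}$ has an atom at its supremum or that the density is continuous and nonzero there. It is assumed $\mathbb{E}[\mathcal{D}]=1$. The noisy oracle satisfies $\tilde f(S)=\xi_Sf(S)$ with $\xi_S$ i.i.d. from $\mathcal{D}$ (one draw per set). A $\beta$-approximation is an $S\in\mathcal{I}(\mathcal{M})$ with $f(S)\ge\beta\max_{T\in\mathcal{I}(\mathcal{M})}f(T)$. *)

theory Defs
  imports "HOL-Probability.Probability"
begin

subsection \<open>Submodular functions and matroids\<close>

definition submodular_on :: "'a set \<Rightarrow> ('a set \<Rightarrow> real) \<Rightarrow> bool" where
  "submodular_on N f \<longleftrightarrow>
     (\<forall>A B. A \<subseteq> N \<longrightarrow> B \<subseteq> N \<longrightarrow> f (A \<union> B) + f (A \<inter> B) \<le> f A + f B)"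

definition objective_on :: "'a set \<Rightarrow> ('a set \<Rightarrow> real) \<Rightarrow> bool" where
  "objective_on N f \<longleftrightarrow>
     (\<forall>S. S \<subseteq> N \<longrightarrow> 0 \<le> f S) \<and>
     (\<forall>S T. S \<subseteq> T \<longrightarrow> T \<subseteq> N \<longrightarrow> f S \<le> f T) \<and>
     submodular_on N f \<and> f {} = 0"

definition matroid :: "'a set \<Rightarrow> 'a set set \<Rightarrow> bool" where
  "matroid N \<I> \<longleftrightarrow>
     finite N \<and> \<I> \<subseteq> Pow N \<and> {} \<in> \<I> \<and>
     (\<forall>I J. J \<in> \<I> \<longrightarrow> I \<subseteq> J \<longrightarrow> I \<in> \<I>) \<and>
     (\<forall>I\<in>\<I>. \<forall>J\<in>\<I>. card I < card J \<longrightarrow> (\<exists>e\<in>J - I. insert e I \<in> \<I>))"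

definition matroid_rank :: "'a set set \<Rightarrow> nat" where
  "matroid_rank \<I> = Max (card ` \<I>)"

definition approximation :: "'a set set \<Rightarrow> ('a set \<Rightarrow> real) \<Rightarrow> real \<Rightarrow> 'a set \<Rightarrow> bool" where
  "approximation \<I> f \<beta> S \<longleftrightarrow> S \<in> \<I> \<and> \<beta> * Max (f ` \<I>) \<le> f S"

subsection \<open>Noise distributions\<close>

definition has_density_on :: "real measure \<Rightarrow> (real \<Rightarrow> real) \<Rightarrow> real set \<Rightarrow> bool" where
  "has_density_on D p X \<longleftrightarrow>
     p \<in> borel_measurable borel \<and> (\<forall>x\<in>X. 0 \<le> p x) \<and>
     (\<forall>A\<in>sets borel. A \<subseteq> X \<longrightarrow> emeasure D A = (\<integral>\<^sup>+x\<in>A. ennreal (p x) \<partial>lborel))"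

definition measure_support :: "real measure \<Rightarrow> real set" where
  "measure_support D = {x. \<forall>U. open U \<longrightarrow> x \<in> U \<longrightarrow> measure D U > 0}"

text \<open>
  The exponent is a series, so finite sums are covered by letting \<open>c\<close> vanish eventually.
  The condition \<open>0 \<le> x0\<close> loses nothing, since a tail threshold can be increased; it keeps the
  base of \<open>powr\<close> positive.
\<close>

definition exponential_tail :: "real measure \<Rightarrow> bool" where
  "exponential_tail D \<longleftrightarrow>
     (\<exists>x0\<ge>0. \<exists>(c :: nat \<Rightarrow> real) (\<gamma> :: nat \<Rightarrow> real).
        decseq \<gamma> \<and> \<gamma> 0 \<ge> 1 \<and> c 0 > 0 \<and>
        (\<forall>x>x0. summable (\<lambda>i. c i * x powr \<gamma> i)) \<and>
        has_density_on D (\<lambda>x. exp (- (\<Sum>i. c i * x powr \<gamma> i))) {x0<..})"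

text \<open>
  A density vanishes to the right of the supremum of the support, so continuity there can only
  mean continuity from the left.
\<close>

definition bounded_tail :: "real measure \<Rightarrow> bool" where
  "bounded_tail D \<longleftrightarrow>
     bounded (measure_support D) \<and>
     (let s = Sup (measure_support D) in
        measure D {s} > 0 \<or>
        (\<exists>\<delta>>0. \<exists>p. has_density_on D p {s - \<delta><..s} \<and> continuous (at_left s) p \<and> p s \<noteq> 0))"

definition generalized_exponential_tail :: "real measure \<Rightarrow> bool" where
  "generalized_exponential_tail D \<longleftrightarrow> exponential_tail D \<or> bounded_tail D"

definition noise_distribution :: "real measure \<Rightarrow> bool" where
  "noise_distribution D \<longleftrightarrow>
     prob_space D \<and> sets D = sets borel \<and>
     integrable D (\<lambda>x. x) \<and> (LINT x|D. x) = 1 \<and>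
     generalized_exponential_tail D"

subsection \<open>Randomized adaptive algorithms with oracle access\<close>

text \<open>
  An algorithm is a well-founded decision tree: it stops with an output set, queries the value
  oracle, queries the independence oracle, or draws internal randomness, and continues depending
  on the answer. Only the oracle answers carry information about the instance.
\<close>

datatype 'a oracle_alg =
    Output "'a set"
  | Ask_Value "'a set" "real \<Rightarrow> 'a oracle_alg"
  | Ask_Indep "'a set" "bool \<Rightarrow> 'a oracle_alg"
  | Draw "nat pmf" "nat \<Rightarrow> 'a oracle_alg"

text \<open>Joint law of the output and of the number of value queries made.\<close>

primrec run :: "'a oracle_alg \<Rightarrow> ('a set \<Rightarrow> real) \<Rightarrow> ('a set \<Rightarrow> bool) \<Rightarrow> ('a set \<times> nat) pmf" where
  "run (Output S) val ind = return_pmf (S, 0)"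
| "run (Ask_Value S k) val ind = map_pmf (\<lambda>(T, q). (T, Suc q)) (run (k (val S)) val ind)"
| "run (Ask_Indep S k) val ind = run (k (ind S)) val ind"
| "run (Draw p k) val ind = bind_pmf p (\<lambda>i. run (k i) val ind)"

text \<open>
  One independent draw \<open>\<xi> S\<close> for each \<open>S \<subseteq> N\<close>; asking the same set again gives the same answer.
  The values of \<open>f\<close> outside \<open>Pow N\<close> are irrelevant, as \<open>objective_on\<close> leaves them arbitrary.
\<close>

definition noise_space :: "'a set \<Rightarrow> real measure \<Rightarrow> ('a set \<Rightarrow> real) measure" where
  "noise_space N D = (\<Pi>\<^sub>M S\<in>Pow N. D)"

definition run_noisy ::
    "'a oracle_alg \<Rightarrow> 'a set set \<Rightarrow> ('a set \<Rightarrow> real) \<Rightarrow> ('a set \<Rightarrow> real) \<Rightarrow> ('a set \<times> nat) pmf" where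
  "run_noisy alg \<I> f \<xi> = run alg (\<lambda>S. \<xi> S * f S) (\<lambda>S. S \<in> \<I>)"

text \<open>
  Probability over both the noise and the internal randomness that the output is a
  \<open>\<beta>\<close>-approximation. If the integrand is not measurable, the integral is 0, so
  non-measurable algorithms gain nothing.
\<close>

definition success_prob ::
    "'a oracle_alg \<Rightarrow> 'a set \<Rightarrow> real measure \<Rightarrow> 'a set set \<Rightarrow> ('a set \<Rightarrow> real) \<Rightarrow> real \<Rightarrow> real" where
  "success_prob alg N D \<I> f \<beta> =
     (LINT \<xi>|noise_space N D.
        measure_pmf.prob (run_noisy alg \<I> f \<xi>) {(S, q). approximation \<I> f \<beta> S})"

end

theory Submission
  imports Defs "HOL-Real_Asymp.Real_Asymp"
begin

text \<open>
  Fix a set \<open>X \<subseteq> N\<close> of about \<open>r sqrt n\<close> elements and smooth \<open>f\<close> to \<open>F S = avg\<^sub>x f (S \<union> {x})\<close> over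
  \<open>x \<in> X\<close>. The average of the positive parts of the noisy values of the sets \<open>S \<union> {x}\<close> estimates
  \<open>F S\<close> up to a constant factor that is the same for all \<open>S\<close> (the mean of the clipped noise), so
  neither the noise law nor the scale of \<open>f\<close> need be known: greedy only compares scores. Since \<open>F\<close>
  is again monotone and submodular, a greedy base \<open>A\<close> satisfies \<open>2 F A - F {} \<ge> OPT\<close> up to a small
  error, while \<open>f A \<ge> F A - F {}\<close>. If \<open>F A \<ge> 2 F {}\<close>, this gives \<open>f A \<ge> OPT / 3\<close>. Otherwise
  \<open>F {} \<ge> OPT / 3\<close>, that is, a random element of \<open>X\<close> has value \<open>OPT / 3\<close> on average, so a constant
  fraction of \<open>X\<close> has value at least \<open>13/40 OPT\<close>; among \<open>r\<close> random elements of \<open>X\<close>, extended to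
  bases \<open>S\<close>, one of nearly largest value is found by averaging over the sets \<open>S - {y}\<close>, whose mean
  value is at least \<open>(1 - 1 / r) f S\<close>. Both outcomes beat \<open>8/25 > (1 - 1 / e) / 2\<close>. All failure
  probabilities are \<open>O(1 / r^4)\<close>, because the upper tail of every noise law allowed here decays faster than any power.
\<close>

subsection \<open>Tails of the noise\<close>

text \<open>The size of \<open>X\<close> balances accuracy against queries. Over \<open>r\<close>
  greedy steps the errors add up, so a score that sums \<open>m = card X\<close> positive parts must
  be accurate to about m OPT / r; with noise cut at level B, Hoeffding's inequality gives an
  exponent of order m / (r^2 B^2). For m about r sqrt n, r = O(n^(1/3)) and B = n^(1/24) this is
  n^(1/12), enough for a union bound over r n candidates, while all greedy queries together number
  at most r n m, about r^2 n^(3/2). Positive parts are taken because an exponential tail restricts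
  only large positive noise. The obstacle is adaptivity: greedy chooses its sets by noise that it
  has read. Scores therefore skip the \<open>x\<close> in \<open>S\<close>, which separates the
  noise of successive steps by the cardinality of the sets. The constants descend 1/3 > 33/100 >
  13/40 > 8/25: the gaps pay for the estimation error, for the passage from an average over
  \<open>X\<close> to many large elements, and for removing one element of a base and estimating
  again. The parameter \<epsilon> enters through 1 / \<epsilon> \<le> r, which turns 1 / r^4 into
  \<epsilon>^4.\<close>

lemma Abel_summation_bound:
  fixes b w :: "nat \<Rightarrow> real"
  assumes "decseq w" and "\<And>i. w i \<ge> 0" and bound: "\<And>j. \<bar>\<Sum>i<j. b i\<bar> \<le> M"
  shows "\<bar>\<Sum>i<n. b i * w i\<bar> \<le> M * w 0"
proof -
  let ?S = "\<lambda>j. \<Sum>i<j. b i"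
  have step: "w (Suc i) \<le> w i" for i
    using assms(1) by (simp add: decseq_Suc_iff)
  \<comment> \<open>Summation by parts moves the differences onto the weights. As \<open>w\<close>
    decreases, they are nonnegative and telescope, so only the partial sums of \<open>b\<close> need
    a bound; the series may converge conditionally.\<close>
  have "(\<Sum>i<n. b i * w i) = ?S n * w n + (\<Sum>i<n. ?S (Suc i) * (w i - w (Suc i)))"
    by (induction n) (simp_all add: algebra_simps)
  also have "\<bar>\<dots>\<bar> \<le> \<bar>?S n * w n\<bar> + (\<Sum>i<n. \<bar>?S (Suc i) * (w i - w (Suc i))\<bar>)"
    by (intro order_trans[OF abs_triangle_ineq] add_left_mono sum_abs)
  also have "\<dots> \<le> M * w n + (\<Sum>i<n. M * (w i - w (Suc i)))"
    unfolding abs_mult using assms(2) step bound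
    by (intro add_mono sum_mono mult_mono) (auto simp del: sum.lessThan_Suc intro: order_trans[OF abs_ge_zero bound])
  also have "(\<Sum>i<n. M * (w i - w (Suc i))) = M * (w 0 - w n)"
    by (simp add: sum_distrib_left[symmetric] sum_lessThan_telescope')
  finally show ?thesis
    by (simp add: algebra_simps)
qed

text \<open>For \<open>y \<ge> 1\<close> the powers are decreasing weights in \<open>i\<close>, so
  summation by parts applies. The bound \<open>M\<close> on the partial sums of \<open>b\<close>
  does not involve \<open>y\<close>.\<close>

lemma powr_series_tail_bound:
  fixes b \<gamma> :: "nat \<Rightarrow> real"
  assumes "decseq \<gamma>" and "summable b"
  shows "\<exists>M. \<forall>y\<ge>1. summable (\<lambda>i. b i * y powr \<gamma> i) \<longrightarrow> \<bar>\<Sum>i. b i * y powr \<gamma> i\<bar> \<le> M * y powr \<gamma> 0"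
proof -
  have "convergent (\<lambda>n. \<Sum>i<n. b i)"
    using assms(2) by (simp add: summable_iff_convergent)
  then obtain M where M: "\<And>n. \<bar>\<Sum>i<n. b i\<bar> \<le> M"
    using convergent_imp_Bseq[of "\<lambda>n. \<Sum>i<n. b i"] by (auto simp: Bseq_def)
  have "\<bar>\<Sum>i. b i * y powr \<gamma> i\<bar> \<le> M * y powr \<gamma> 0"
    if y: "y \<ge> 1" and sm: "summable (\<lambda>i. b i * y powr \<gamma> i)" for y
  proof (rule tendsto_upperbound[of _ _ sequentially])
    show "(\<lambda>n. \<bar>\<Sum>i<n. b i * y powr \<gamma> i\<bar>) \<longlonglongrightarrow> \<bar>\<Sum>i. b i * y powr \<gamma> i\<bar>"
      by (intro tendsto_intros summable_LIMSEQ sm)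
    have "decseq (\<lambda>i. y powr \<gamma> i)"
      using assms(1) y by (auto simp: decseq_def intro!: powr_mono)
    then show "\<forall>\<^sub>F n in sequentially. \<bar>\<Sum>i<n. b i * y powr \<gamma> i\<bar> \<le> M * y powr \<gamma> 0"
      by (intro always_eventually allI Abel_summation_bound M) auto
  qed auto
  then show ?thesis by blast
qed

text \<open>
  The exponents may be tied, so a prefix of the series can cancel identically. Dropping the longest
  such prefix exposes the leading term.
\<close>

lemma powr_series_leading_term:
  fixes b \<gamma> :: "nat \<Rightarrow> real"
  assumes dec: "decseq \<gamma>" and sm: "\<And>y. y \<ge> 1 \<Longrightarrow> summable (\<lambda>i. b i * y powr \<gamma> i)"
  shows "(\<forall>y\<ge>1. (\<Sum>i. b i * y powr \<gamma> i) = 0) \<or>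
    (\<exists>s lam mu M. s \<noteq> 0 \<and> mu < lam \<and> (\<forall>y\<ge>1. \<bar>(\<Sum>i. b i * y powr \<gamma> i) - s * y powr lam\<bar> \<le> M * y powr mu))"
proof -
  define K where "K = {k. \<forall>y\<ge>1. (\<Sum>i<k. b i * y powr \<gamma> i) = 0}"
  have smb: "summable b"
    using sm[of 1] by simp
  show ?thesis
  proof (cases "finite K")
    case False
    have "(\<Sum>i. b i * y powr \<gamma> i) = 0" if y: "y \<ge> 1" for y
    proof -
      have "(\<lambda>n. \<Sum>i<n. b i * y powr \<gamma> i) \<longlonglongrightarrow> (\<Sum>i. b i * y powr \<gamma> i)"
        by (rule summable_LIMSEQ[OF sm[OF y]])
      then have "((\<lambda>n. \<Sum>i<n. b i * y powr \<gamma> i) \<circ> enumerate K) \<longlonglongrightarrow> (\<Sum>i. b i * y powr \<gamma> i)"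
        by (rule LIMSEQ_subseq_LIMSEQ) (rule strict_mono_enumerate[OF False])
      moreover have "(\<lambda>n. \<Sum>i<n. b i * y powr \<gamma> i) \<circ> enumerate K = (\<lambda>_. 0)"
        using enumerate_in_set[OF False] y by (auto simp: K_def fun_eq_iff)
      ultimately show ?thesis
        by (simp add: LIMSEQ_const_iff)
    qed
    then show ?thesis by blast
  next
    case True
    define k where "k = Max K"
    have "0 \<in> K" by (simp add: K_def)
    then have kK: "k \<in> K" and kmax: "\<And>j. j \<in> K \<Longrightarrow> j \<le> k"
      using Max_in[OF True] Max_ge[OF True] unfolding k_def by blast+
    have split: "(\<Sum>i. b i * y powr \<gamma> i) = (\<Sum>i<j. b i * y powr \<gamma> i) + (\<Sum>i. b (i + j) * y powr \<gamma> (i + j))"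
      if "y \<ge> 1" for y j
      using suminf_split_initial_segment[OF sm[OF that], of j] by simp
    \<comment> \<open>Either all exponents from \<open>k\<close> on agree, and what remains is a
      single power, or the first drop after \<open>k\<close> ends the block of terms that forms the
      leading power. Its coefficient is nonzero because \<open>k\<close> is maximal.\<close>
    show ?thesis
    proof (cases "\<exists>j>k. \<gamma> j < \<gamma> k")
      case False
      then have "\<gamma> k \<le> \<gamma> (i + k)" for i
        by (metis add_0 less_add_same_cancel2 linorder_le_less_linear neq0_conv order_refl)
      then have const: "\<gamma> (i + k) = \<gamma> k" for i
        using decseqD[OF dec, of k "i + k"] by (intro antisym) auto
      define s where "s = (\<Sum>i. b (i + k))"
      have eq: "(\<Sum>i. b i * y powr \<gamma> i) = s * y powr \<gamma> k" if "y \<ge> 1" for y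
      proof -
        have "(\<Sum>i. b (i + k) * y powr \<gamma> (i + k)) = s * y powr \<gamma> k"
          unfolding const s_def
          by (rule suminf_mult2[symmetric]) (use smb in \<open>simp add: summable_iff_shift\<close>)
        then show ?thesis
          using split[OF that, of k] kK that by (simp add: K_def)
      qed
      show ?thesis
      proof (cases "s = 0")
        case True
        then show ?thesis using eq by simp
      next
        case False
        then show ?thesis
          using eq by (intro disjI2 exI[of _ s] exI[of _ "\<gamma> k"] exI[of _ "\<gamma> k - 1"] exI[of _ 0]) auto
      qed
    next
      case True
      define j where "j = (LEAST j. k < j \<and> \<gamma> j < \<gamma> k)"
      have j: "k < j" "\<gamma> j < \<gamma> k"
        using LeastI_ex[OF True] unfolding j_def by auto
      have const: "\<gamma> i = \<gamma> k" if "k \<le> i" "i < j" for i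
      proof (cases "i = k")
        case False
        then have "\<not> (k < i \<and> \<gamma> i < \<gamma> k)"
          using not_less_Least that(2) unfolding j_def by blast
        then show ?thesis
          using that False decseqD[OF dec that(1)] by auto
      qed auto
      define s where "s = (\<Sum>i=k..<j. b i)"
      have prefix: "(\<Sum>i<j. b i * y powr \<gamma> i) = s * y powr \<gamma> k" if "y \<ge> 1" for y
      proof -
        have "(\<Sum>i<j. b i * y powr \<gamma> i) = (\<Sum>i<k. b i * y powr \<gamma> i) + (\<Sum>i=k..<j. b i * y powr \<gamma> i)"
          using j by (simp add: lessThan_atLeast0 sum.atLeastLessThan_concat)
        also have "(\<Sum>i=k..<j. b i * y powr \<gamma> i) = s * y powr \<gamma> k"
          unfolding s_def sum_distrib_right
          by (intro sum.cong refl) (metis const atLeastLessThan_iff)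
        finally show ?thesis using kK that by (simp add: K_def)
      qed
      have "s \<noteq> 0"
      proof
        assume "s = 0"
        then have "j \<in> K" using prefix by (simp add: K_def)
        then show False using kmax j by fastforce
      qed
      moreover obtain M where M: "\<And>y. y \<ge> 1 \<Longrightarrow> summable (\<lambda>i. b (i + j) * y powr \<gamma> (i + j)) \<Longrightarrow>
          \<bar>\<Sum>i. b (i + j) * y powr \<gamma> (i + j)\<bar> \<le> M * y powr \<gamma> (0 + j)"
        using powr_series_tail_bound[of "\<lambda>i. \<gamma> (i + j)" "\<lambda>i. b (i + j)"] dec smb
        by (auto simp: decseq_def summable_iff_shift)
      have "\<bar>(\<Sum>i. b i * y powr \<gamma> i) - s * y powr \<gamma> k\<bar> \<le> M * y powr \<gamma> j" if "y \<ge> 1" for y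
        using M[OF that] sm[OF that] split[OF that, of j] prefix[OF that]
        by (simp add: summable_iff_shift[where f = "\<lambda>i. b i * y powr \<gamma> i"])
      ultimately show ?thesis
        using j(2) by blast
    qed
  qed
qed

section \<open>Power bounds for the upper tail under both tail conditions\<close>

lemma decaying_density_tail:
  assumes "prob_space D" and setsD: "sets D = sets borel"
    and dens: "has_density_on D p {x0<..}"
    and ev: "\<forall>\<^sub>F x in at_top. p x \<le> x powr - (real q + 1)" and q: "q > 0"
  shows "\<exists>C>0. \<forall>B\<ge>1. measure D {B<..} \<le> C / B ^ q"
proof -
  interpret prob_space D by fact
  obtain z where z: "z \<ge> 1" "z \<ge> x0" "\<And>x. x \<ge> z \<Longrightarrow> p x \<le> x powr - (real q + 1)"
  proof -
    from ev obtain z0 where "\<And>x. x \<ge> z0 \<Longrightarrow> p x \<le> x powr - (real q + 1)"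
      by (auto simp: eventually_at_top_linorder)
    then show ?thesis using that[of "max z0 (max x0 1)"] by auto
  qed
  have large: "measure D {B<..} \<le> 1 / B ^ q" if B: "B \<ge> z" for B
  proof -
    have B1: "B > 0" using B z by linarith
    have "emeasure D {B<..} = (\<integral>\<^sup>+x\<in>{B<..}. ennreal (p x) \<partial>lborel)"
      using dens B z unfolding has_density_on_def by auto
    also have "\<dots> \<le> (\<integral>\<^sup>+x. ennreal (x powr - (real q + 1)) * indicator {B..} x \<partial>lborel)"
      by (intro nn_integral_mono) (use z B in \<open>auto simp: indicator_def intro!: ennreal_leI\<close>)
    also have "\<dots> = ennreal (0 - - (B powr - real q) / real q)"
    proof (rule nn_integral_FTC_atLeast)
      show "((\<lambda>x. - (x powr - real q) / real q) has_real_derivative x powr - (real q + 1)) (at x)" if "B \<le> x" for x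
      proof -
        have "- real q - 1 = - (real q + 1)" by simp
        then show ?thesis
          using that B1 q by (auto intro!: derivative_eq_intros)
      qed
      show "((\<lambda>x. - (x powr - real q) / real q) \<longlongrightarrow> 0) at_top"
        using q by real_asymp
    qed auto
    also have "\<dots> \<le> ennreal (1 / B ^ q)"
      using q B1 by (intro ennreal_leI) (simp add: powr_minus powr_realpow field_simps)
    finally show ?thesis
      using B1 by (simp add: emeasure_eq_measure)
  qed
  \<comment> \<open>Below \<open>z\<close> the density is not controlled; there the constant
    \<open>z ^ q\<close> makes the bound trivial, since a probability is at most 1.\<close>
  have "measure D {B<..} \<le> z ^ q / B ^ q" if B: "B \<ge> 1" for B
  proof (cases "B \<ge> z")
    case True
    then show ?thesis
      using large[OF True] z(1) B
      by (smt (verit) divide_right_mono one_le_power zero_le_power)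
  next
    case False
    then have "B ^ q \<le> z ^ q" using B by (intro power_mono) auto
    moreover have "measure D {B<..} \<le> 1" by simp
    ultimately show ?thesis using B by (smt (verit) le_divide_eq_1_pos zero_less_power)
  qed
  moreover have "z ^ q > 0" using z by simp
  ultimately show ?thesis by blast
qed

text \<open>An interval of length \<open>2 / c\<close> to the right of \<open>z\<close> would have
  mass at least 2. This rules out that the exponent of an exponential density is eventually bounded
  above.\<close>

lemma density_not_bounded_below:
  assumes "prob_space D" and "has_density_on D p {x0<..}" and "c > 0" and "z \<ge> x0"
    and "\<And>x. x > z \<Longrightarrow> p x \<ge> c"
  shows False
proof -
  interpret prob_space D by fact
  define R where "R = 2 / c"
  have "ennreal 2 = (\<integral>\<^sup>+x. ennreal c * indicator {z<..z+R} x \<partial>lborel)"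
    using assms(3) by (simp add: nn_integral_cmult R_def ennreal_mult[symmetric])
  also have "\<dots> \<le> (\<integral>\<^sup>+x\<in>{z<..z+R}. ennreal (p x) \<partial>lborel)"
    by (intro nn_integral_mono) (use assms(5) in \<open>auto simp: indicator_def intro!: ennreal_leI\<close>)
  also have "\<dots> = emeasure D {z<..z+R}"
  proof -
    have "{z<..z+R} \<subseteq> {x0<..}" using assms(4) by auto
    then show ?thesis using assms(2) unfolding has_density_on_def by (metis greaterThanAtMost_borel)
  qed
  also have "\<dots> \<le> ennreal 1"
    by (simp add: emeasure_eq_measure)
  finally show False by (simp del: ennreal_numeral add: ennreal_le_iff)
qed

text \<open>Ties among the exponents can cancel the coefficients of a power, so the direction of
  growth is read off from the total mass: a leading term with \<open>lam \<le> 0\<close> or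
  \<open>s < 0\<close> would keep the density away from 0 on a half-line. Hence the exponent grows
  like a positive power of \<open>x\<close>, and the density falls below every
  \<open>x powr - (real q + 1)\<close>.\<close>

lemma exponential_tail_bound:
  assumes "prob_space D" and "sets D = sets borel" and "exponential_tail D" and q: "q > 0"
  shows "\<exists>C>0. \<forall>B\<ge>1. measure D {B<..} \<le> C / B ^ q"
proof -
  obtain x0 c \<gamma> where x0: "x0 \<ge> 0" and dec: "decseq \<gamma>"
    and sm: "\<And>x. x > x0 \<Longrightarrow> summable (\<lambda>i. c i * x powr \<gamma> i)"
    and dens: "has_density_on D (\<lambda>x. exp (- (\<Sum>i. c i * x powr \<gamma> i))) {x0<..}"
    using assms(3) unfolding exponential_tail_def by blast
  \<comment> \<open>Rescaling by \<open>x1\<close> turns the range \<open>x \<ge> x1\<close> into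
    \<open>y \<ge> 1\<close>, as the series lemmas require. Being strictly beyond \<open>x0\<close>
    makes the series summable at \<open>y = 1\<close> as well.\<close>
  define x1 where "x1 = x0 + 1"
  have x1: "x1 > x0" "x1 > 0" using x0 by (auto simp: x1_def)
  define g where "g = (\<lambda>x. \<Sum>i. c i * x powr \<gamma> i)"
  define b where "b = (\<lambda>i. c i * x1 powr \<gamma> i)"
  have term_eq: "c i * (x1 * y) powr \<gamma> i = b i * y powr \<gamma> i" if "y \<ge> 1" for i y
    using that x1 by (simp add: b_def powr_mult)
  have smb: "summable (\<lambda>i. b i * y powr \<gamma> i)" if "y \<ge> 1" for y
  proof -
    have "x1 * 1 \<le> x1 * y" using that x1 by (intro mult_left_mono) auto
    with x1 have "x0 < x1 * y" by linarith
    from sm[OF this] show ?thesis using term_eq[OF that] by simp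
  qed
  have g_eq: "g x = (\<Sum>i. b i * (x / x1) powr \<gamma> i)" if "x \<ge> x1" for x
    using term_eq[of "x / x1"] that x1 by (simp add: g_def)
  have unbounded: False if bnd: "\<forall>\<^sub>F x in at_top. g x \<le> U" for U
  proof -
    obtain z where z: "\<And>x. x \<ge> z \<Longrightarrow> g x \<le> U"
      using bnd by (auto simp: eventually_at_top_linorder)
    show False
      by (rule density_not_bounded_below[OF assms(1) dens, of "exp (- U)" "max z x0"])
        (use z in \<open>auto simp: g_def\<close>)
  qed
  have "\<not> (\<forall>y\<ge>1. (\<Sum>i. b i * y powr \<gamma> i) = 0)"
  proof
    assume zero: "\<forall>y\<ge>1. (\<Sum>i. b i * y powr \<gamma> i) = 0"
    have "g x \<le> 0" if "x \<ge> x1" for x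
      using g_eq[OF that] zero that x1 by auto
    then show False
      by (intro unbounded[of 0]) (auto simp: eventually_at_top_linorder)
  qed
  then obtain s lam mu M where s: "s \<noteq> 0" and "mu < lam"
    and lead: "\<And>y. y \<ge> 1 \<Longrightarrow> \<bar>(\<Sum>i. b i * y powr \<gamma> i) - s * y powr lam\<bar> \<le> M * y powr mu"
    using powr_series_leading_term[of \<gamma> b] dec smb by blast
  have close: "\<forall>\<^sub>F x in at_top. \<bar>g x - s * (x / x1) powr lam\<bar> \<le> M * (x / x1) powr mu"
    using eventually_ge_at_top[of x1]
  proof eventually_elim
    case (elim x)
    then show ?case using lead[of "x / x1"] g_eq[OF elim] x1 by simp
  qed
  have ratio: "\<forall>\<^sub>F x in at_top. M * (x / x1) powr mu \<le> \<bar>s\<bar> / 2 * (x / x1) powr lam"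
  proof -
    have "((\<lambda>x. M * (x / x1) powr (mu - lam)) \<longlongrightarrow> 0) at_top"
      using x1 \<open>mu < lam\<close> by real_asymp
    then have "\<forall>\<^sub>F x in at_top. M * (x / x1) powr (mu - lam) < \<bar>s\<bar> / 2"
      by (rule order_tendstoD(2)) (use s in auto)
    then show ?thesis
      using eventually_ge_at_top[of x1]
    proof eventually_elim
      case (elim x)
      then have "M * (x / x1) powr (mu - lam) * (x / x1) powr lam \<le> \<bar>s\<bar> / 2 * (x / x1) powr lam"
        by (intro mult_right_mono) auto
      then show ?case by (simp add: mult.assoc powr_add[symmetric])
    qed
  qed
  have "lam > 0"
  proof (rule ccontr)
    assume "\<not> lam > 0"
    have "\<forall>\<^sub>F x in at_top. g x \<le> 3 / 2 * \<bar>s\<bar>"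
      using close ratio eventually_ge_at_top[of x1]
    proof eventually_elim
      case (elim x)
      have "(x / x1) powr lam \<le> (x / x1) powr 0"
        using elim x1 \<open>\<not> lam > 0\<close> by (intro powr_mono) auto
      then have "(x / x1) powr lam \<le> 1" using elim x1 by simp
      then have "\<bar>s\<bar> * (x / x1) powr lam \<le> \<bar>s\<bar> * 1"
        by (intro mult_left_mono) auto
      moreover have "s * (x / x1) powr lam \<le> \<bar>s\<bar> * (x / x1) powr lam"
        by (intro mult_right_mono) auto
      ultimately show ?case using elim by (simp add: abs_le_iff field_simps)
    qed
    then show False by (rule unbounded)
  qed
  moreover have "s > 0"
  proof (rule ccontr)
    assume "\<not> s > 0"
    have "\<forall>\<^sub>F x in at_top. g x \<le> 0"
      using close ratio
    proof eventually_elim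
      case (elim x)
      have "s * (x / x1) powr lam \<le> 0"
        using \<open>\<not> s > 0\<close> by (simp add: mult_le_0_iff)
      then show ?case using elim \<open>\<not> s > 0\<close> by (simp add: abs_le_iff)
    qed
    then show False by (rule unbounded)
  qed
  ultimately have "\<forall>\<^sub>F x in at_top. exp (- (s / 2 * (x / x1) powr lam)) \<le> x powr - (real q + 1)"
    using x1(2) by real_asymp
  then have "\<forall>\<^sub>F x in at_top. exp (- g x) \<le> x powr - (real q + 1)"
    using close ratio
  proof eventually_elim
    case (elim x)
    have "g x \<ge> s / 2 * (x / x1) powr lam"
      using elim \<open>s > 0\<close> by (simp add: abs_le_iff)
    then have "exp (- g x) \<le> exp (- (s / 2 * (x / x1) powr lam))" by simp
    then show ?case using elim by linarith
  qed
  then show ?thesis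
    using decaying_density_tail[OF assms(1,2) dens _ q] by (simp add: g_def)
qed

text \<open>The complement is the union of all open null sets, possibly uncountably many; the
  Lindelof property reduces them to countably many.\<close>

lemma measure_support_compl_null:
  assumes "prob_space D" and "sets D = sets borel"
  shows "measure D (- measure_support D) = 0"
proof -
  interpret prob_space D by fact
  define \<U> where "\<U> = {U. open U \<and> measure D U = 0}"
  have "- measure_support D = \<Union>\<U>"
    by (auto simp: measure_support_def \<U>_def less_le)
  moreover obtain \<V> where \<V>: "\<V> \<subseteq> \<U>" "countable \<V>" "\<Union>\<V> = \<Union>\<U>"
    using Lindelof[of \<U>] by (auto simp: \<U>_def)
  moreover have "(\<Union>V\<in>\<V>. V) \<in> null_sets D"
    using \<V> by (intro null_sets_UN') (auto simp: \<U>_def null_sets_def assms(2) emeasure_eq_measure)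
  ultimately show ?thesis by (simp add: null_sets_def measure_def)
qed

lemma bounded_tail_bound:
  assumes "prob_space D" and "sets D = sets borel" and "bounded_tail D"
  shows "\<exists>C>0. \<forall>B\<ge>1. measure D {B<..} \<le> C / B ^ q"
proof -
  interpret prob_space D by fact
  obtain s where s: "\<And>x. x \<in> measure_support D \<Longrightarrow> x \<le> s"
    using assms(3) unfolding bounded_tail_def bounded_real by (auto simp: abs_le_iff)
  define z where "z = max s 1"
  have "measure D {B<..} \<le> z ^ q / B ^ q" if B: "B \<ge> 1" for B
  proof (cases "B \<ge> z")
    case True
    have "- measure_support D \<in> sets D"
    proof -
      have "- measure_support D = \<Union>{U. open U \<and> measure D U = 0}"
        by (auto simp: measure_support_def less_le)
      then have "open (- measure_support D)" by auto
      then show ?thesis using assms(2) by auto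
    qed
    then have "measure D {B<..} \<le> measure D (- measure_support D)"
      using s True by (intro finite_measure_mono) (fastforce simp: z_def)+
    then show ?thesis
      using measure_support_compl_null[OF assms(1,2)] B by (simp add: z_def order_trans[of _ 0])
  next
    case False
    then have "B ^ q \<le> z ^ q" using B by (intro power_mono) auto
    moreover have "measure D {B<..} \<le> 1" by simp
    ultimately show ?thesis using B by (smt (verit) le_divide_eq_1_pos zero_less_power)
  qed
  moreover have "z ^ q > 0" by (simp add: z_def)
  ultimately show ?thesis by blast
qed

text \<open>The common form in which both kinds of tail enter the probability estimates. The final
  parameters use order 168.\<close>

lemma noise_tail_bound:
  assumes "noise_distribution D" and "q > 0"
  shows "\<exists>C>0. \<forall>B\<ge>1. measure D {B<..} \<le> C / B ^ q"
  using assms exponential_tail_bound bounded_tail_bound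
  unfolding noise_distribution_def generalized_exponential_tail_def by metis

subsection \<open>Concentration of sums of noisy values\<close>

text \<open>Up to random error, a score is this factor times a sum of true values. It depends on the
  level \<open>B\<close> and not on the set, so it cancels when scores of one kind are
  compared.\<close>

definition clipped_mean :: "real measure \<Rightarrow> real \<Rightarrow> real" where
  "clipped_mean D B = (LINT x|D. min (max 0 x) B)"

locale noise_model =
  fixes D :: "real measure" and N :: "'a set"
  assumes prob_space_D: "prob_space D" and sets_D: "sets D = sets borel" and finite_N: "finite N"
begin

abbreviation "\<Omega> \<equiv> noise_space N D"

sublocale D: prob_space D
  by (rule prob_space_D)

sublocale noise: prob_space \<Omega>
  unfolding noise_space_def by (intro prob_space_PiM prob_space_D)

section \<open>Law and independence of the single noise values\<close>

lemma borel_measurable_D: "borel_measurable D = borel_measurable borel"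
  by (rule measurable_cong_sets) (simp_all add: sets_D)

lemma measurable_coordinate:
  assumes "S \<in> J"
  shows "(\<lambda>\<xi>. \<xi> S) \<in> borel_measurable (Pi\<^sub>M J (\<lambda>_. D))"
  using measurable_component_singleton[OF assms, of "\<lambda>_. D"]
  by (simp add: measurable_cong_sets[OF refl sets_D])

lemma measurable_noise: "S \<subseteq> N \<Longrightarrow> (\<lambda>\<xi>. \<xi> S) \<in> borel_measurable \<Omega>"
  unfolding noise_space_def by (rule measurable_coordinate) simp

lemma distr_coordinate: "S \<subseteq> N \<Longrightarrow> distr \<Omega> D (\<lambda>\<xi>. \<xi> S) = D"
  unfolding noise_space_def by (subst distr_PiM_component) (auto intro: prob_space_D)

lemma indep_coordinates: "noise.indep_vars (\<lambda>_. D) (\<lambda>S \<xi>. \<xi> S) (Pow N)"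
proof (subst noise.indep_vars_iff_distr_eq_PiM')
  have "distr \<Omega> (Pi\<^sub>M (Pow N) (\<lambda>_. D)) (\<lambda>\<xi>. \<lambda>S\<in>Pow N. \<xi> S) = distr \<Omega> \<Omega> (\<lambda>\<xi>. \<xi>)"
    by (intro distr_cong) (auto simp: noise_space_def space_PiM)
  also have "\<dots> = Pi\<^sub>M (Pow N) (\<lambda>S. distr \<Omega> D (\<lambda>\<xi>. \<xi> S))"
  proof -
    have "Pi\<^sub>M (Pow N) (\<lambda>S. distr \<Omega> D (\<lambda>\<xi>. \<xi> S)) = \<Omega>"
      by (subst (2) noise_space_def) (intro PiM_cong refl distr_coordinate, auto)
    then show ?thesis by simp
  qed
  finally show "distr \<Omega> (Pi\<^sub>M (Pow N) (\<lambda>_. D)) (\<lambda>\<xi>. \<lambda>S\<in>Pow N. \<xi> S) =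
      Pi\<^sub>M (Pow N) (\<lambda>S. distr \<Omega> D (\<lambda>\<xi>. \<xi> S))" .
qed (auto simp: noise_space_def)

text \<open>The form of independence used against adaptivity: \<open>E\<close> will fix what greedy
  has chosen so far, \<open>E'\<close> will concern noise that had no part in the choice.\<close>

lemma prob_disjoint_coordinates:
  assumes "J \<inter> J' = {}" and "J \<subseteq> Pow N" and "J' \<subseteq> Pow N"
    and "E \<in> sets (Pi\<^sub>M J (\<lambda>_. D))" and "E' \<in> sets (Pi\<^sub>M J' (\<lambda>_. D))"
  shows "noise.prob {\<xi>\<in>space \<Omega>. restrict \<xi> J \<in> E \<and> restrict \<xi> J' \<in> E'} =
    noise.prob {\<xi>\<in>space \<Omega>. restrict \<xi> J \<in> E} * noise.prob {\<xi>\<in>space \<Omega>. restrict \<xi> J' \<in> E'}"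
  using noise.indep_varD[OF noise.indep_var_restrict[OF indep_coordinates assms(1-3)] assms(4,5)]
  by (simp add: vimage_def Int_def conj_commute conj_left_commute)

lemma clipped_mean_coordinate:
  assumes "S \<subseteq> N"
  shows "noise.expectation (\<lambda>\<xi>. min (max 0 (\<xi> S)) B) = clipped_mean D B"
proof -
  have "clipped_mean D B = (LINT x|distr \<Omega> D (\<lambda>\<xi>. \<xi> S). min (max 0 x) B)"
    by (simp add: clipped_mean_def distr_coordinate[OF assms])
  also have "\<dots> = noise.expectation (\<lambda>\<xi>. min (max 0 (\<xi> S)) B)"
    using assms by (intro integral_distr) (auto simp: borel_measurable_D noise_space_def)
  finally show ?thesis ..
qed

lemma prob_coordinate_greater:
  assumes "S \<subseteq> N"
  shows "noise.prob {\<xi>\<in>space \<Omega>. \<xi> S > B} = measure D {B<..}"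
proof -
  have "measure D {B<..} = measure (distr \<Omega> D (\<lambda>\<xi>. \<xi> S)) {B<..}"
    by (simp add: distr_coordinate[OF assms])
  also have "\<dots> = noise.prob ((\<lambda>\<xi>. \<xi> S) -` {B<..} \<inter> space \<Omega>)"
    using assms by (intro measure_distr) (auto simp: sets_D noise_space_def)
  also have "(\<lambda>\<xi>. \<xi> S) -` {B<..} \<inter> space \<Omega> = {\<xi>\<in>space \<Omega>. \<xi> S > B}"
    by auto
  finally show ?thesis ..
qed

text \<open>Positive parts may be unbounded, so Hoeffding's inequality is applied to the variables
  cut at \<open>B\<close>. The two sums agree unless some noise value exceeds \<open>B\<close>,
  which the last term covers by a union bound.\<close>

lemma clipped_sum_concentration:
  assumes \<S>: "\<S> \<subseteq> Pow N" and w: "\<And>S. S \<in> \<S> \<Longrightarrow> 0 \<le> w S \<and> w S \<le> W"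
    and W: "W > 0" and B: "B > 0" and t: "t > 0"
  shows "noise.prob {\<xi>\<in>space \<Omega>. \<bar>(\<Sum>S\<in>\<S>. max 0 (\<xi> S * w S)) - clipped_mean D B * (\<Sum>S\<in>\<S>. w S)\<bar> \<ge> t}
    \<le> 2 * exp (- 2 * t\<^sup>2 / (real (card \<S>) * (B * W)\<^sup>2)) + real (card \<S>) * measure D {B<..}"
proof (cases "\<S> = {}")
  case True
  then show ?thesis using t by simp
next
  case False
  have fin: "finite \<S>"
    using \<S> finite_N by (meson finite_Pow_iff finite_subset)
  then have card: "card \<S> > 0" using False by (simp add: card_gt_0_iff)
  define Y where "Y = (\<lambda>S \<xi>. min (max 0 (\<xi> S)) B * w S)"
  have meas: "(\<lambda>\<xi>. \<xi> S) \<in> borel_measurable \<Omega>" if "S \<in> \<S>" for S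
    using that \<S> by (intro measurable_noise) auto
  have indep: "noise.indep_vars (\<lambda>_. borel) Y \<S>"
    unfolding Y_def
    by (rule noise.indep_vars_compose2[OF noise.indep_vars_subset[OF indep_coordinates \<S>],
          where Y = "\<lambda>S x. min (max 0 x) B * w S"]) (simp add: borel_measurable_D)
  have mean: "noise.expectation (Y S) = clipped_mean D B * w S" if "S \<in> \<S>" for S
    using clipped_mean_coordinate[of S B] that \<S> by (auto simp: Y_def)
  interpret H: Hoeffding_ineq \<Omega> \<S> Y "\<lambda>_. 0" "\<lambda>_. B * W" "clipped_mean D B * (\<Sum>S\<in>\<S>. w S)"
  proof unfold_locales
    show "AE \<xi> in \<Omega>. Y S \<xi> \<in> {0..B * W}" if "S \<in> \<S>" for S
    proof (rule AE_I2)
      fix \<xi>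
      have "min (max 0 (\<xi> S)) B * w S \<le> B * W"
        using w[OF that] B by (intro mult_mono) auto
      then show "Y S \<xi> \<in> {0..B * W}"
        using w[OF that] B by (auto simp: Y_def)
    qed
    show "clipped_mean D B * (\<Sum>S\<in>\<S>. w S) \<equiv> (\<Sum>S\<in>\<S>. noise.expectation (Y S))"
      by (rule eq_reflection) (simp add: mean sum_distrib_left)
  qed (use fin indep in auto)
  let ?dev = "\<lambda>Z. {\<xi>\<in>space \<Omega>. \<bar>(\<Sum>S\<in>\<S>. Z S \<xi>) - clipped_mean D B * (\<Sum>S\<in>\<S>. w S)\<bar> \<ge> t}"
  let ?V = "\<lambda>S \<xi>. max 0 (\<xi> S * w S)"
  let ?big = "\<lambda>S. {\<xi>\<in>space \<Omega>. \<xi> S > B}"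
  have sets_Y: "?dev Y \<in> sets \<Omega>"
    unfolding Y_def using meas by measurable
  have sets_big: "?big S \<in> sets \<Omega>" if "S \<in> \<S>" for S
    using meas[OF that] by measurable
  have "?dev ?V \<subseteq> ?dev Y \<union> (\<Union>S\<in>\<S>. ?big S)"
  proof
    fix \<xi> assume \<xi>: "\<xi> \<in> ?dev ?V"
    show "\<xi> \<in> ?dev Y \<union> (\<Union>S\<in>\<S>. ?big S)"
    proof (cases "\<exists>S\<in>\<S>. \<xi> S > B")
      case False
      have "?V S \<xi> = Y S \<xi>" if "S \<in> \<S>" for S
        using False that w[OF that] B by (auto simp: Y_def max_def min_def mult_le_0_iff zero_le_mult_iff)
      then show ?thesis using \<xi> by simp
    qed (use \<xi> in auto)
  qed
  then have "noise.prob (?dev ?V) \<le> noise.prob (?dev Y \<union> (\<Union>S\<in>\<S>. ?big S))"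
    using sets_Y sets_big fin by (intro noise.finite_measure_mono sets.Un sets.finite_UN)
  also have "\<dots> \<le> noise.prob (?dev Y) + noise.prob (\<Union>S\<in>\<S>. ?big S)"
    using sets_Y sets_big fin by (intro measure_Un_le sets.finite_UN)
  also have "noise.prob (\<Union>S\<in>\<S>. ?big S) \<le> (\<Sum>S\<in>\<S>. noise.prob (?big S))"
    using sets_big fin by (intro noise.finite_measure_subadditive_finite) auto
  also have "\<dots> = real (card \<S>) * measure D {B<..}"
    using \<S> by (simp add: prob_coordinate_greater subset_iff)
  also have "noise.prob (?dev Y) \<le> 2 * exp (- 2 * t\<^sup>2 / (\<Sum>S\<in>\<S>. (B * W - 0)\<^sup>2))"
    using H.Hoeffding_ineq_abs_ge[of t] t B W card by simp
  finally show ?thesis by simp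
qed

text \<open>Makes \<open>clipped_mean D 1\<close> a lower bound for all levels
  \<open>B \<ge> 1\<close>, so \<open>B\<close> may grow with the instance while the factor stays
  away from 0.\<close>

lemma clipped_mean_mono:
  assumes "0 \<le> B" "B \<le> B'"
  shows "clipped_mean D B \<le> clipped_mean D B'"
  unfolding clipped_mean_def using assms
  by (intro integral_mono D.integrable_const_bound[where B = B'])
    (auto simp: borel_measurable_D)

lemma clipped_mean_pos:
  assumes "integrable D (\<lambda>x. x)" and "(LINT x|D. x) = 1"
  shows "clipped_mean D 1 > 0"
proof (rule ccontr)
  assume "\<not> clipped_mean D 1 > 0"
  moreover have "clipped_mean D 1 \<ge> 0"
    unfolding clipped_mean_def by simp
  ultimately have "clipped_mean D 1 = 0"
    by linarith
  then have "(LINT x|D. min (max 0 x) 1) = 0"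
    by (simp add: clipped_mean_def)
  then have "AE x in D. min (max 0 x) (1::real) = 0"
    by (subst (asm) integral_nonneg_eq_0_iff_AE)
      (auto intro!: D.integrable_const_bound[where B = 1] simp: borel_measurable_D)
  then have "AE x in D. x \<le> 0"
    by eventually_elim (auto simp: min_def max_def split: if_splits)
  then have "(LINT x|D. x) \<le> (LINT x|D. 0)"
    using assms by (intro integral_mono_AE) auto
  then show False using assms by simp
qed

end

subsection \<open>Smoothed objectives and greedy bases\<close>

lemma objective_nonneg: "objective_on N f \<Longrightarrow> S \<subseteq> N \<Longrightarrow> 0 \<le> f S"
  and objective_mono: "objective_on N f \<Longrightarrow> S \<subseteq> T \<Longrightarrow> T \<subseteq> N \<Longrightarrow> f S \<le> f T"
  and objective_empty: "objective_on N f \<Longrightarrow> f {} = 0"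
  and objective_submodular: "objective_on N f \<Longrightarrow> S \<subseteq> N \<Longrightarrow> T \<subseteq> N \<Longrightarrow> f (S \<union> T) + f (S \<inter> T) \<le> f S + f T"
  by (auto simp: objective_on_def submodular_on_def)

lemma objective_Un_le:
  assumes "objective_on N f" "S \<subseteq> N" "T \<subseteq> N"
  shows "f (S \<union> T) \<le> f S + f T"
proof -
  have "f (S \<union> T) + f (S \<inter> T) \<le> f S + f T"
    by (rule objective_submodular[OF assms])
  moreover have "0 \<le> f (S \<inter> T)"
    using assms by (intro objective_nonneg) auto
  ultimately show ?thesis by simp
qed

lemma objective_diminishing_returns:
  assumes f: "objective_on N f" and "S \<subseteq> T" "T \<subseteq> N" "e \<in> N"
  shows "f (insert e T) - f T \<le> f (insert e S) - f S"
proof (cases "e \<in> T")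
  case True
  then show ?thesis
    using objective_mono[OF f, of S "insert e S"] assms by (auto simp: insert_absorb)
next
  case False
  have "f (insert e S \<union> T) + f (insert e S \<inter> T) \<le> f (insert e S) + f T"
    using objective_submodular[OF f, of "insert e S" T] assms by auto
  moreover have "insert e S \<union> T = insert e T" "insert e S \<inter> T = S"
    using False assms by auto
  ultimately show ?thesis by simp
qed

text \<open>Insert the elements of \<open>S\<close> one by one. Removing \<open>y\<close> from
  \<open>S\<close> costs no more than \<open>y\<close> gained when it was inserted into a smaller
  set, and these gains telescope. So the average loss is at most \<open>f S / card S\<close>, which
  makes the sets \<open>S - {y}\<close> a proxy for \<open>S\<close>.\<close>

lemma sum_removal_losses_le:
  assumes f: "objective_on N f" and "S \<subseteq> N" "finite S"
  shows "(\<Sum>y\<in>S. f S - f (S - {y})) \<le> f S"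
proof -
  have "(\<Sum>y\<in>T. f S - f (S - {y})) \<le> f T" if "T \<subseteq> S" for T
    using finite_subset[OF that \<open>finite S\<close>] that
  proof (induction T rule: finite_induct)
    case empty
    then show ?case using objective_empty[OF f] by simp
  next
    case (insert y T)
    have "f (insert y (S - {y})) - f (S - {y}) \<le> f (insert y T) - f T"
      using insert assms by (intro objective_diminishing_returns[OF f]) auto
    moreover have "insert y (S - {y}) = S" using insert by auto
    ultimately show ?case using insert by simp
  qed
  then show ?thesis by blast
qed

lemma sum_removals_bounds:
  assumes f: "objective_on N f" and "S \<subseteq> N" "finite S"
  shows "(real (card S) - 1) * f S \<le> (\<Sum>y\<in>S. f (S - {y}))"
    and "(\<Sum>y\<in>S. f (S - {y})) \<le> real (card S) * f S"
proof -
  show "(real (card S) - 1) * f S \<le> (\<Sum>y\<in>S. f (S - {y}))"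
    using sum_removal_losses_le[OF assms] by (simp add: sum_subtractf algebra_simps)
  have "f (S - {y}) \<le> f S" for y
    using assms by (intro objective_mono[OF f]) auto
  then show "(\<Sum>y\<in>S. f (S - {y})) \<le> real (card S) * f S"
    by (intro sum_bounded_above) auto
qed

text \<open>Every \<open>x\<close> in \<open>X\<close> is kept, also those in \<open>S\<close>: in
  this form monotonicity and diminishing returns are inherited term by term. Scores skip the
  \<open>x\<close> in \<open>S\<close>, and the difference is booked as an error.\<close>

definition smoothed :: "'a set \<Rightarrow> ('a set \<Rightarrow> real) \<Rightarrow> 'a set \<Rightarrow> real" where
  "smoothed X f S = (\<Sum>x\<in>X. f (insert x S))"

lemma smoothed_mono:
  assumes "objective_on N f" "X \<subseteq> N" "S \<subseteq> T" "T \<subseteq> N"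
  shows "smoothed X f S \<le> smoothed X f T"
  unfolding smoothed_def using assms by (intro sum_mono objective_mono[OF assms(1)]) auto

lemma smoothed_diminishing_returns:
  assumes "objective_on N f" "X \<subseteq> N" "S \<subseteq> T" "T \<subseteq> N" "e \<in> N"
  shows "smoothed X f (insert e T) - smoothed X f T \<le> smoothed X f (insert e S) - smoothed X f S"
  unfolding smoothed_def sum_subtractf[symmetric]
proof (rule sum_mono)
  fix x assume "x \<in> X"
  then show "f (insert x (insert e T)) - f (insert x T) \<le> f (insert x (insert e S)) - f (insert x S)"
    using objective_diminishing_returns[OF assms(1), of "insert x S" "insert x T" e] assms
    by (auto simp: insert_commute)
qed

text \<open>Subadditivity separates \<open>x\<close> from \<open>S\<close>; this converts an
  increase of the smoothed value into true value of \<open>S\<close>.\<close>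

lemma smoothed_le:
  assumes "objective_on N f" "X \<subseteq> N" "S \<subseteq> N"
  shows "smoothed X f S \<le> smoothed X f {} + real (card X) * f S"
proof -
  have "f (insert x S) \<le> f {x} + f S" if "x \<in> X" for x
    using objective_Un_le[OF assms(1), of "{x}" S] assms that by auto
  then have "smoothed X f S \<le> (\<Sum>x\<in>X. f {x} + f S)"
    unfolding smoothed_def by (rule sum_mono)
  then show ?thesis by (simp add: smoothed_def sum.distrib)
qed

section \<open>Bases of a matroid and the exchange argument for greedy\<close>

lemma matroid_subset_finite:
  assumes "matroid N \<I>" "S \<in> \<I>"
  shows "S \<subseteq> N" and "finite S"
  using assms by (auto simp: matroid_def intro: finite_subset)

lemma matroid_augment:
  assumes "matroid N \<I>" "S \<in> \<I>" "T \<in> \<I>" "card S < card T"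
  shows "\<exists>e\<in>T - S. insert e S \<in> \<I>"
  using assms unfolding matroid_def by blast

lemma matroid_card_le_rank:
  assumes "matroid N \<I>" "S \<in> \<I>"
  shows "card S \<le> matroid_rank \<I>"
  unfolding matroid_rank_def using assms
  by (intro Max_ge) (auto simp: matroid_def intro: finite_subset)

lemma matroid_rank_attained:
  assumes "matroid N \<I>"
  obtains S where "S \<in> \<I>" "card S = matroid_rank \<I>"
proof -
  have "matroid_rank \<I> \<in> card ` \<I>"
    unfolding matroid_rank_def using assms
    by (intro Max_in) (auto simp: matroid_def intro: finite_subset)
  then show ?thesis using that by auto
qed

lemma matroid_extend_to_rank:
  assumes M: "matroid N \<I>" and "S \<in> \<I>"
  shows "\<exists>T\<in>\<I>. S \<subseteq> T \<and> card T = matroid_rank \<I>"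
  using \<open>S \<in> \<I>\<close>
proof (induction "matroid_rank \<I> - card S" arbitrary: S)
  case 0
  then show ?case using matroid_card_le_rank[OF M, of S] by auto
next
  case (Suc k)
  obtain T where T: "T \<in> \<I>" "card T = matroid_rank \<I>"
    using matroid_rank_attained[OF M] .
  moreover have "card S < matroid_rank \<I>" using Suc by linarith
  ultimately obtain e where e: "e \<in> T - S" "insert e S \<in> \<I>"
    using matroid_augment[OF M Suc.prems T(1)] by auto
  have "finite S" using matroid_subset_finite[OF M Suc.prems] by simp
  then have "k = matroid_rank \<I> - card (insert e S)" using Suc e by simp
  from Suc.hyps(1)[OF this e(2)] show ?case by auto
qed

text \<open>No matching between \<open>Q\<close> and the greedy base is built in advance.
  Augmentation finds an \<open>e\<close> in \<open>Q\<close> that was a candidate at step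
  \<open>i\<close>; its gain on top of \<open>A r\<close> is at most its gain on top of
  \<open>A i\<close>, hence at most the greedy gain plus \<open>\<eta>\<close>. Dropping
  \<open>e\<close> from \<open>Q\<close> continues the induction, and the greedy gains
  telescope.\<close>

lemma approximate_greedy_bound:
  fixes A :: "nat \<Rightarrow> 'a set"
  assumes f: "objective_on N f" and M: "matroid N \<I>" and X: "X \<subseteq> N" and "\<eta> \<ge> 0"
    and A: "\<And>i. i \<le> r \<Longrightarrow> A i \<in> \<I> \<and> card (A i) = i"
    and chain: "\<And>i. i < r \<Longrightarrow> A i \<subseteq> A (Suc i)"
    and greedy: "\<And>i e. i < r \<Longrightarrow> e \<in> N - A i \<Longrightarrow> insert e (A i) \<in> \<I> \<Longrightarrow>
      smoothed X f (insert e (A i)) \<le> smoothed X f (A (Suc i)) + \<eta>"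
    and "Q \<in> \<I>" "card Q \<le> r"
  shows "smoothed X f (A r \<union> Q) \<le> 2 * smoothed X f (A r) - smoothed X f {} + real r * \<eta>"
proof -
  let ?G = "smoothed X f"
  have sub: "A i \<subseteq> A r" if "i \<le> r" for i
    using that
  proof (induction rule: inc_induct)
    case (step i)
    then show ?case using chain by blast
  qed simp
  have AN: "A i \<subseteq> N" if "i \<le> r" for i
    using A[OF that] M by (auto simp: matroid_def)
  \<comment> \<open>Stated for all \<open>Q\<close> because \<open>Q\<close> loses elements along
    the way. In the step to \<open>Suc i\<close>, monotonicity suffices if
    \<open>card Q \<le> i\<close>; otherwise \<open>Q\<close> is larger than \<open>A i\<close> and
    augmentation applies.\<close>
  have main: "?G (A r \<union> Q) \<le> ?G (A r) + (?G (A i) - ?G (A 0) + real i * \<eta>)"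
    if "i \<le> r" "Q \<in> \<I>" "card Q \<le> i" for i Q
    using that
  proof (induction i arbitrary: Q)
    case 0
    have "finite Q" using 0 M by (auto simp: matroid_def intro: finite_subset)
    then show ?case using 0 by simp
  next
    case (Suc i)
    have QN: "Q \<subseteq> N" "finite Q" using Suc M by (auto simp: matroid_def intro: finite_subset)
    have mono: "?G (A i) \<le> ?G (A (Suc i))"
      using Suc.prems chain[of i] AN by (intro smoothed_mono[OF f X]) auto
    show ?case
    proof (cases "card Q \<le> i")
      case True
      then show ?thesis
        using Suc.IH[of Q] Suc.prems mono \<open>\<eta> \<ge> 0\<close> by (simp add: algebra_simps)
    next
      case False
      then obtain e where e: "e \<in> Q - A i" "insert e (A i) \<in> \<I>"
        using matroid_augment[OF M, of "A i" Q] A[of i] Suc.prems by auto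
      have Q': "Q - {e} \<in> \<I>" "card (Q - {e}) \<le> i"
        using Suc.prems M e QN by (auto simp: matroid_def card_Diff_singleton)
      have "?G (insert e (A r \<union> (Q - {e}))) - ?G (A r \<union> (Q - {e})) \<le> ?G (insert e (A i)) - ?G (A i)"
        using e QN AN[of r] sub[of i] Suc.prems
        by (intro smoothed_diminishing_returns[OF f X]) auto
      moreover have "insert e (A r \<union> (Q - {e})) = A r \<union> Q" using e by auto
      moreover have "?G (insert e (A i)) \<le> ?G (A (Suc i)) + \<eta>"
        using greedy[of i e] Suc.prems e QN by auto
      ultimately show ?thesis
        using Suc.IH[OF _ Q'] Suc.prems by (simp add: algebra_simps)
    qed
  qed
  have "A 0 = {}"
    using A[of 0] matroid_subset_finite[OF M, of "A 0"] by simp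
  then show ?thesis
    using main[OF order_refl \<open>Q \<in> \<I>\<close> \<open>card Q \<le> r\<close>] by (simp add: algebra_simps)
qed

subsection \<open>The algorithm\<close>

primrec ask_list ::
    "'a set list \<Rightarrow> ('a set \<Rightarrow> real) \<Rightarrow> (('a set \<Rightarrow> real) \<Rightarrow> 'a oracle_alg) \<Rightarrow> 'a oracle_alg" where
  "ask_list [] g k = k g"
| "ask_list (S # Ss) g k = Ask_Value S (\<lambda>v. ask_list Ss (g(S := v)) k)"

text \<open>Distinctness makes the number of queries equal to \<open>card \<S>\<close>. The table
  handed on is 0 at sets not asked; congruence lemmas later replace it by the oracle itself.\<close>

definition ask_all :: "'a set set \<Rightarrow> (('a set \<Rightarrow> real) \<Rightarrow> 'a oracle_alg) \<Rightarrow> 'a oracle_alg" where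
  "ask_all \<S> k = ask_list (SOME l. set l = \<S> \<and> distinct l) (\<lambda>_. 0) k"

lemma run_ask_list:
  "run (ask_list l g k) val ind =
     map_pmf (\<lambda>(T, q). (T, q + length l)) (run (k (\<lambda>S. if S \<in> set l then val S else g S)) val ind)"
proof (induction l arbitrary: g)
  case Nil
  then show ?case by (simp add: map_pmf_idI)
next
  case (Cons S l)
  have "(\<lambda>S'. if S' \<in> set l then val S' else (g(S := val S)) S') =
      (\<lambda>S'. if S' \<in> set (S # l) then val S' else g S')"
    by (auto simp: fun_eq_iff)
  then show ?case
    by (simp add: Cons.IH pmf.map_comp o_def case_prod_unfold del: fun_upd_apply)
qed

lemma run_ask_all:
  assumes "finite \<S>"
  shows "run (ask_all \<S> k) val ind =
    map_pmf (\<lambda>(T, q). (T, q + card \<S>)) (run (k (\<lambda>S. if S \<in> \<S> then val S else 0)) val ind)"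
proof -
  have "\<exists>l. set l = \<S> \<and> distinct l"
    using finite_distinct_list[OF assms] by blast
  then have l: "set (SOME l. set l = \<S> \<and> distinct l) = \<S> \<and> distinct (SOME l. set l = \<S> \<and> distinct l)"
    by (rule someI_ex)
  then have "length (SOME l. set l = \<S> \<and> distinct l) = card \<S>"
    by (metis distinct_card)
  then show ?thesis
    using l by (simp add: ask_all_def run_ask_list)
qed

primrec ask_indep_list ::
    "'a set list \<Rightarrow> 'a set set \<Rightarrow> ('a set set \<Rightarrow> 'a oracle_alg) \<Rightarrow> 'a oracle_alg" where
  "ask_indep_list [] \<J> k = k \<J>"
| "ask_indep_list (S # Ss) \<J> k = Ask_Indep S (\<lambda>b. ask_indep_list Ss (if b then insert S \<J> else \<J>) k)"

text \<open>\<open>run\<close> counts value queries alone, so the matroid can be tabulated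
  completely before the search starts.\<close>

definition learn_indep :: "'a set \<Rightarrow> ('a set set \<Rightarrow> 'a oracle_alg) \<Rightarrow> 'a oracle_alg" where
  "learn_indep N k = ask_indep_list (SOME l. set l = Pow N) {} k"

lemma run_learn_indep:
  assumes "finite N"
  shows "run (learn_indep N k) val ind = run (k {S. S \<subseteq> N \<and> ind S}) val ind"
proof -
  have list: "run (ask_indep_list l \<J> k) val ind = run (k (\<J> \<union> {S\<in>set l. ind S})) val ind" for l \<J>
  proof (induction l arbitrary: \<J>)
    case (Cons S l)
    have "(if ind S then insert S \<J> else \<J>) \<union> {S\<in>set l. ind S} = \<J> \<union> {S'\<in>set (S # l). ind S'}"
      by auto
    then show ?case using Cons[of "if ind S then insert S \<J> else \<J>"] by simp
  qed simp
  have "\<exists>l. set l = Pow N"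
    using assms by (intro finite_list) auto
  then have "set (SOME l. set l = Pow N) = Pow N"
    by (rule someI_ex)
  then show ?thesis by (simp add: learn_indep_def list)
qed

text \<open>\<open>Draw\<close> yields natural numbers, so a list over \<open>X\<close> is coded
  through the positions of its entries in an enumeration of \<open>X\<close>; decoding is exact on
  the support of \<open>P\<close>.\<close>

lemma run_draw_list:
  assumes "finite X" and "set_pmf P \<subseteq> lists X"
  shows "run (Draw (map_pmf (\<lambda>l. to_nat (map (to_nat_on X) l)) P)
      (\<lambda>j. k (map (from_nat_into X) (from_nat j)))) val ind = bind_pmf P (\<lambda>l. run (k l) val ind)"
proof -
  have "map (from_nat_into X \<circ> to_nat_on X) l = l" if "l \<in> set_pmf P" for l
    using assms that by (intro map_idI) (auto simp: countable_finite in_lists_conv_set subset_iff)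
  then show ?thesis
    by (auto simp: bind_map_pmf intro!: bind_pmf_cong)
qed

text \<open>A choice from the set of maximizers: the result depends on \<open>h\<close> only through
  that set, which gives congruence and reduces measurability to finitely many comparisons.\<close>

definition best :: "('b \<Rightarrow> real) \<Rightarrow> 'b set \<Rightarrow> 'b" where
  "best h E = (SOME e. e \<in> {e\<in>E. \<forall>e'\<in>E. h e' \<le> h e})"

lemma best_in:
  assumes "finite E" "E \<noteq> {}"
  shows "best h E \<in> E" and "e \<in> E \<Longrightarrow> h e \<le> h (best h E)"
proof -
  have "Max (h ` E) \<in> h ` E" using assms by (intro Max_in) auto
  then obtain e\<^sub>0 where "e\<^sub>0 \<in> E" "h e\<^sub>0 = Max (h ` E)" by auto
  then have "e\<^sub>0 \<in> {e\<in>E. \<forall>e'\<in>E. h e' \<le> h e}" using assms by auto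
  then have "best h E \<in> {e\<in>E. \<forall>e'\<in>E. h e' \<le> h e}"
    unfolding best_def by (rule someI)
  then show "best h E \<in> E" and "e \<in> E \<Longrightarrow> h e \<le> h (best h E)" by auto
qed

lemma best_cong: "(\<And>e. e \<in> E \<Longrightarrow> h e = h' e) \<Longrightarrow> best h E = best h' E"
  unfolding best_def by (rule arg_cong[where f = "\<lambda>E. SOME e. e \<in> E"]) auto

text \<open>Skipping the \<open>x\<close> in \<open>S\<close> makes the sets read pairwise distinct
  and all of cardinality \<open>card S + 1\<close>. Distinctness gives independent noise, the common
  cardinality makes that noise fresh during greedy.\<close>

definition neighbour_score :: "'a set \<Rightarrow> ('a set \<Rightarrow> real) \<Rightarrow> 'a set \<Rightarrow> real" where
  "neighbour_score X v S = (\<Sum>x\<in>X - S. max 0 (v (insert x S)))"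

text \<open>One noisy value says little about \<open>S\<close>. The sets with one element removed
  carry independent noise, and by submodularity their mean value is close to \<open>f S\<close> when
  \<open>S\<close> is large.\<close>

definition removal_score :: "('a set \<Rightarrow> real) \<Rightarrow> 'a set \<Rightarrow> real" where
  "removal_score v S = (\<Sum>y\<in>S. max 0 (v (S - {y})))"

definition feasible :: "'a set \<Rightarrow> 'a set set \<Rightarrow> 'a set \<Rightarrow> 'a set" where
  "feasible N \<I> A = {e\<in>N - A. insert e A \<in> \<I>}"

definition greedy_step :: "'a set \<Rightarrow> 'a set set \<Rightarrow> 'a set \<Rightarrow> ('a set \<Rightarrow> real) \<Rightarrow> 'a set \<Rightarrow> 'a set" where
  "greedy_step N \<I> X v A = insert (best (\<lambda>e. neighbour_score X v (insert e A)) (feasible N \<I> A)) A"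

definition greedy :: "'a set \<Rightarrow> 'a set set \<Rightarrow> 'a set \<Rightarrow> ('a set \<Rightarrow> real) \<Rightarrow> nat \<Rightarrow> 'a set" where
  "greedy N \<I> X v i = (greedy_step N \<I> X v ^^ i) {}"

definition base_of :: "'a set set \<Rightarrow> nat \<Rightarrow> 'a \<Rightarrow> 'a set" where
  "base_of \<I> r x = (SOME S. S \<in> \<I> \<and> x \<in> S \<and> card S = r)"

text \<open>The threshold 2 balances the two cases: if F A = 2 F {}, then 2 F A - F {} \<ge> OPT
  leaves a third of OPT for F A - F {} and for F {} alike.\<close>

definition decide ::
    "'a set set \<Rightarrow> nat \<Rightarrow> 'a set \<Rightarrow> ('a set \<Rightarrow> real) \<Rightarrow> 'a set \<Rightarrow> 'a set \<Rightarrow> 'a set" where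
  "decide \<I> r X v A Z =
     (if 2 * neighbour_score X v {} \<le> neighbour_score X v A then A
      else base_of \<I> r (best (\<lambda>x. removal_score v (base_of \<I> r x)) Z))"

definition step_queries :: "'a set \<Rightarrow> 'a set set \<Rightarrow> 'a set \<Rightarrow> 'a set \<Rightarrow> 'a set set" where
  "step_queries N \<I> X A = (\<lambda>(e, x). insert x (insert e A)) ` (feasible N \<I> A \<times> X)"

text \<open>When \<open>A\<close> is the greedy base, the sets \<open>insert x A\<close> with
  \<open>x\<close> outside \<open>A\<close> were read in the last greedy step. Asking again returns
  the same noise: it costs queries but brings no new randomness.\<close>

definition final_queries :: "'a set set \<Rightarrow> nat \<Rightarrow> 'a set \<Rightarrow> 'a set \<Rightarrow> 'a set \<Rightarrow> 'a set set" where
  "final_queries \<I> r X A Z =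
     (\<lambda>x. insert x A) ` X \<union> (\<lambda>x. {x}) ` X \<union> (\<Union>x\<in>Z. (\<lambda>y. base_of \<I> r x - {y}) ` base_of \<I> r x)"

primrec greedy_alg ::
    "'a set \<Rightarrow> 'a set set \<Rightarrow> 'a set \<Rightarrow> nat \<Rightarrow> 'a set \<Rightarrow> ('a set \<Rightarrow> 'a oracle_alg) \<Rightarrow> 'a oracle_alg" where
  "greedy_alg N \<I> X 0 A k = k A"
| "greedy_alg N \<I> X (Suc j) A k =
     ask_all (step_queries N \<I> X A) (\<lambda>v. greedy_alg N \<I> X j (greedy_step N \<I> X v A) k)"

definition sample_set :: "'a set \<Rightarrow> nat \<Rightarrow> 'a set" where
  "sample_set N r = (SOME X. X \<subseteq> N \<and> card X = r * nat \<lfloor>sqrt (real (card N))\<rfloor>)"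

text \<open>The list is drawn before any value is read, so a run is a mixture over lists, and for a
  fixed list the output is a function of the noise alone.\<close>

definition noisy_alg :: "'a set \<Rightarrow> nat \<Rightarrow> 'a oracle_alg" where
  "noisy_alg N r = (let X = sample_set N r in
     learn_indep N (\<lambda>\<I>.
       Draw (map_pmf (\<lambda>l. to_nat (map (to_nat_on X) l)) (replicate_pmf r (pmf_of_set X))) (\<lambda>j.
         greedy_alg N \<I> X r {} (\<lambda>A.
           let Z = set (map (from_nat_into X) (from_nat j)) in
           ask_all (final_queries \<I> r X A Z) (\<lambda>v. Output (decide \<I> r X v A Z))))))"

lemma neighbour_score_cong:
  "(\<And>x. x \<in> X \<Longrightarrow> v (insert x S) = v' (insert x S)) \<Longrightarrow> neighbour_score X v S = neighbour_score X v' S"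
  unfolding neighbour_score_def by (intro sum.cong) auto

lemma greedy_step_cong:
  assumes "\<And>S. S \<in> step_queries N \<I> X A \<Longrightarrow> v S = v' S"
  shows "greedy_step N \<I> X v A = greedy_step N \<I> X v' A"
proof -
  have "best (\<lambda>e. neighbour_score X v (insert e A)) (feasible N \<I> A) =
      best (\<lambda>e. neighbour_score X v' (insert e A)) (feasible N \<I> A)"
    by (intro best_cong neighbour_score_cong assms) (auto simp: step_queries_def)
  then show ?thesis by (simp add: greedy_step_def)
qed

lemma decide_cong:
  assumes "\<And>S. S \<in> final_queries \<I> r X A Z \<Longrightarrow> v S = v' S"
  shows "decide \<I> r X v A Z = decide \<I> r X v' A Z"
proof -
  have "best (\<lambda>x. removal_score v (base_of \<I> r x)) Z = best (\<lambda>x. removal_score v' (base_of \<I> r x)) Z"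
    unfolding removal_score_def
    by (intro best_cong sum.cong refl arg_cong[where f = "max 0"] assms) (auto simp: final_queries_def)
  moreover have "neighbour_score X v S = neighbour_score X v' S" if "S = {} \<or> S = A" for S
    using that by (intro neighbour_score_cong assms) (auto simp: final_queries_def)
  ultimately show ?thesis by (simp add: decide_def)
qed

section \<open>Query counts and the law of the output\<close>

lemma card_step_queries:
  assumes "finite N" "finite X"
  shows "finite (step_queries N \<I> X A)" and "card (step_queries N \<I> X A) \<le> card N * card X"
proof -
  have fin: "finite (feasible N \<I> A)" "card (feasible N \<I> A) \<le> card N"
    using assms by (auto simp: feasible_def intro!: card_mono)
  then show "finite (step_queries N \<I> X A)"
    using assms by (simp add: step_queries_def)
  have "card (step_queries N \<I> X A) \<le> card (feasible N \<I> A \<times> X)"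
    unfolding step_queries_def using fin assms by (intro card_image_le) auto
  also have "\<dots> \<le> card N * card X" using fin by (simp add: card_cartesian_product)
  finally show "card (step_queries N \<I> X A) \<le> card N * card X" .
qed

lemma card_final_queries:
  assumes "finite X" "finite Z" "\<And>x. x \<in> Z \<Longrightarrow> finite (base_of \<I> r x) \<and> card (base_of \<I> r x) = r"
  shows "finite (final_queries \<I> r X A Z)"
    and "card (final_queries \<I> r X A Z) \<le> 2 * card X + card Z * r"
proof -
  show "finite (final_queries \<I> r X A Z)"
    using assms by (auto simp: final_queries_def)
  have "card (\<Union>x\<in>Z. (\<lambda>y. base_of \<I> r x - {y}) ` base_of \<I> r x)
      \<le> (\<Sum>x\<in>Z. card ((\<lambda>y. base_of \<I> r x - {y}) ` base_of \<I> r x))"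
    by (rule card_UN_le) (rule assms)
  also have "\<dots> \<le> (\<Sum>x\<in>Z. r)"
    using assms(3) by (intro sum_mono) (metis card_image_le)
  finally have "card (\<Union>x\<in>Z. (\<lambda>y. base_of \<I> r x - {y}) ` base_of \<I> r x) \<le> card Z * r" by simp
  moreover have "card ((\<lambda>x. insert x A) ` X) \<le> card X" "card ((\<lambda>x. {x}) ` X) \<le> card X"
    using assms by (auto intro: card_image_le)
  ultimately show "card (final_queries \<I> r X A Z) \<le> 2 * card X + card Z * r"
    unfolding final_queries_def by (intro order_trans[OF card_Un_le] add_mono order_trans[OF card_Un_le]) auto
qed

lemma run_greedy_alg:
  assumes "finite N" "finite X"
  shows "\<exists>c \<le> j * (card N * card X). \<forall>k. run (greedy_alg N \<I> X j A k) val ind =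
    map_pmf (\<lambda>(T, q). (T, q + c)) (run (k ((greedy_step N \<I> X val ^^ j) A)) val ind)"
proof (induction j arbitrary: A)
  case 0
  show ?case by (simp add: map_pmf_idI)
next
  case (Suc j)
  let ?Q = "step_queries N \<I> X A"
  obtain c where c: "c \<le> j * (card N * card X)"
    "\<And>k. run (greedy_alg N \<I> X j (greedy_step N \<I> X val A) k) val ind =
      map_pmf (\<lambda>(T, q). (T, q + c)) (run (k ((greedy_step N \<I> X val ^^ j) (greedy_step N \<I> X val A))) val ind)"
    using Suc by blast
  have "greedy_step N \<I> X (\<lambda>S. if S \<in> ?Q then val S else 0) A = greedy_step N \<I> X val A"
    by (rule greedy_step_cong) simp
  then have "run (greedy_alg N \<I> X (Suc j) A k) val ind =
      map_pmf (\<lambda>(T, q). (T, q + (c + card ?Q))) (run (k ((greedy_step N \<I> X val ^^ Suc j) A)) val ind)" for k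
    using c(2) card_step_queries(1)[OF assms]
    by (simp add: run_ask_all pmf.map_comp o_def case_prod_unfold funpow_swap1 add.assoc)
  moreover have "c + card ?Q \<le> Suc j * (card N * card X)"
    using c(1) card_step_queries(2)[OF assms, of \<I> A] by simp
  ultimately show ?case by blast
qed

lemma run_noisy_alg:
  fixes N :: "'a set" and r :: nat
  defines "X \<equiv> sample_set N r"
  assumes "finite N" and "\<I> \<subseteq> Pow N" and "finite X" "X \<noteq> {}"
    and base: "\<And>x. x \<in> X \<Longrightarrow> finite (base_of \<I> r x) \<and> card (base_of \<I> r x) = r"
  shows "\<exists>q. run_noisy (noisy_alg N r) \<I> f \<xi> =
      map_pmf (\<lambda>l. (decide \<I> r X (\<lambda>S. \<xi> S * f S) (greedy N \<I> X (\<lambda>S. \<xi> S * f S) r) (set l), q l))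
        (replicate_pmf r (pmf_of_set X)) \<and>
      (\<forall>l\<in>set_pmf (replicate_pmf r (pmf_of_set X)).
        q l \<le> r * (card N * card X) + 2 * card X + r * r)"
proof -
  define val where "val = (\<lambda>S. \<xi> S * f S)"
  define ind where "ind = (\<lambda>S. S \<in> \<I>)"
  define A where "A = greedy N \<I> X val r"
  define P where "P = replicate_pmf r (pmf_of_set X)"
  have P: "l \<in> lists X" "length l = r" if "l \<in> set_pmf P" for l
    using assms that by (auto simp: P_def set_replicate_pmf)
  obtain c where c: "c \<le> r * (card N * card X)"
    "\<And>k. run (greedy_alg N \<I> X r {} k) val ind = map_pmf (\<lambda>(T, q). (T, q + c)) (run (k A) val ind)"
    using run_greedy_alg[OF \<open>finite N\<close> \<open>finite X\<close>, of r \<I> "{}" val ind]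
    by (auto simp: A_def greedy_def)
  define K where "K = (\<lambda>l. greedy_alg N \<I> X r {} (\<lambda>A.
    ask_all (final_queries \<I> r X A (set l)) (\<lambda>v. Output (decide \<I> r X v A (set l)))))"
  define q where "q = (\<lambda>l. card (final_queries \<I> r X A (set l)) + c)"
  have "{S. S \<subseteq> N \<and> ind S} = \<I>"
    using \<open>\<I> \<subseteq> Pow N\<close> by (auto simp: ind_def)
  then have "run (noisy_alg N r) val ind =
      run (Draw (map_pmf (\<lambda>l. to_nat (map (to_nat_on X) l)) P)
        (\<lambda>j. K (map (from_nat_into X) (from_nat j)))) val ind"
    by (simp add: noisy_alg_def X_def[symmetric] P_def run_learn_indep[OF \<open>finite N\<close>] Let_def K_def del: run.simps(4) set_map)
  also have "\<dots> = bind_pmf P (\<lambda>l. run (K l) val ind)"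
    by (rule run_draw_list[OF \<open>finite X\<close>]) (use P in blast)
  also have "\<dots> = bind_pmf P (\<lambda>l. return_pmf (decide \<I> r X val A (set l), q l))"
  proof (rule bind_pmf_cong)
    fix l assume "l \<in> set_pmf P"
    let ?Q = "final_queries \<I> r X A (set l)"
    have "finite ?Q"
      using P[OF \<open>l \<in> set_pmf P\<close>] base \<open>finite X\<close> by (intro card_final_queries) auto
    moreover have "decide \<I> r X (\<lambda>S. if S \<in> ?Q then val S else 0) A (set l) = decide \<I> r X val A (set l)"
      by (rule decide_cong) simp
    ultimately show "run (K l) val ind = return_pmf (decide \<I> r X val A (set l), q l)"
      by (simp add: K_def c(2) run_ask_all q_def)
  qed simp
  finally have "run_noisy (noisy_alg N r) \<I> f \<xi> = map_pmf (\<lambda>l. (decide \<I> r X val A (set l), q l)) P"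
    by (simp add: run_noisy_def map_pmf_def val_def ind_def)
  moreover have "q l \<le> r * (card N * card X) + 2 * card X + r * r" if "l \<in> set_pmf P" for l
  proof -
    have "card (final_queries \<I> r X A (set l)) \<le> 2 * card X + card (set l) * r"
      using P[OF that] base \<open>finite X\<close> by (intro card_final_queries) auto
    moreover have "card (set l) * r \<le> r * r"
      using P[OF that] card_length[of l] by (intro mult_right_mono) auto
    ultimately show ?thesis using c(1) unfolding q_def by linarith
  qed
  ultimately show ?thesis
    unfolding A_def P_def val_def by blast
qed

subsection \<open>Fresh noise along the greedy run\<close>

lemma measurable_best:
  assumes fin: "finite E" and meas: "\<And>e. e \<in> E \<Longrightarrow> (\<lambda>\<omega>. h \<omega> e) \<in> borel_measurable M"
  shows "(\<lambda>\<omega>. best (h \<omega>) E) \<in> measurable M (count_space UNIV)"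
proof -
  define mx where "mx \<omega> = {e\<in>E. \<forall>e'\<in>E. h \<omega> e' \<le> h \<omega> e}" for \<omega>
  have "mx \<in> measurable M (count_space (Pow E))"
    unfolding measurable_count_space_eq_countable[OF countable_finite[OF finite_Pow_iff[THEN iffD2, OF fin]]]
  proof safe
    fix F assume F: "F \<subseteq> E"
    have le: "{\<omega>\<in>space M. \<forall>e'\<in>E. h \<omega> e' \<le> h \<omega> e} \<in> sets M" if "e \<in> E" for e
    proof (rule sets.sets_Collect_finite_All[OF _ fin])
      fix e' assume e': "e' \<in> E"
      show "{\<omega>\<in>space M. h \<omega> e' \<le> h \<omega> e} \<in> sets M"
        by (rule borel_measurable_le[OF meas[OF e'] meas[OF that]])
    qed
    have "mx -` {F} \<inter> space M = {\<omega>\<in>space M. \<forall>e\<in>E. e \<in> F \<longleftrightarrow> (\<forall>e'\<in>E. h \<omega> e' \<le> h \<omega> e)}"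
    proof -
      have "({e\<in>E. P e} = F) = (\<forall>e\<in>E. e \<in> F \<longleftrightarrow> P e)" for P
        using F by blast
      then show ?thesis unfolding mx_def vimage_def Int_def singleton_iff by simp blast
    qed
    also have "\<dots> \<in> sets M"
    proof (rule sets.sets_Collect_finite_All[OF _ fin])
      fix e assume "e \<in> E"
      then show "{\<omega>\<in>space M. e \<in> F \<longleftrightarrow> (\<forall>e'\<in>E. h \<omega> e' \<le> h \<omega> e)} \<in> sets M"
        using le[of e] sets.sets_Collect_neg[OF le[of e]] by (cases "e \<in> F") auto
    qed
    finally show "mx -` {F} \<inter> space M \<in> sets M" .
  qed (auto simp: mx_def)
  then have "(\<lambda>\<omega>. SOME e. e \<in> mx \<omega>) \<in> measurable M (count_space UNIV)"
    by (rule measurable_compose) simp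
  then show ?thesis by (simp add: best_def mx_def)
qed

locale noisy_instance = noise_model D N for D and N :: "'a set" +
  fixes \<I> :: "'a set set" and f :: "'a set \<Rightarrow> real" and r :: nat and X :: "'a set"
  assumes matroid: "matroid N \<I>" and singletons: "\<forall>e\<in>N. {e} \<in> \<I>"
    and rank: "matroid_rank \<I> = r" and objective: "objective_on N f" and X: "X \<subseteq> N"
begin

abbreviation obs :: "('a set \<Rightarrow> real) \<Rightarrow> 'a set \<Rightarrow> real" where
  "obs \<xi> \<equiv> (\<lambda>S. \<xi> S * f S)"

definition opt :: real where
  "opt = Max (f ` \<I>)"

lemma finite_X: "finite X"
  using X finite_N by (rule finite_subset)

lemma finite_indep: "finite \<I>"
  using matroid finite_N by (auto simp: matroid_def intro: finite_subset)

lemma indep_subset: "S \<in> \<I> \<Longrightarrow> S \<subseteq> N" and indep_finite: "S \<in> \<I> \<Longrightarrow> finite S"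
  using matroid_subset_finite[OF matroid] by auto

lemma le_opt: "S \<in> \<I> \<Longrightarrow> f S \<le> opt"
  unfolding opt_def using finite_indep by simp

lemma opt_attained: "\<exists>S\<in>\<I>. f S = opt"
proof -
  have "opt \<in> f ` \<I>"
    unfolding opt_def using finite_indep matroid by (intro Max_in) (auto simp: matroid_def)
  then show ?thesis by auto
qed

text \<open>\<open>insert x S\<close> may be dependent, so \<open>opt\<close> need not bound its
  value. Subadditivity costs a factor 2, which returns as the range \<open>2 * opt\<close> in the
  concentration bound.\<close>

lemma insert_le_opt:
  assumes "S \<in> \<I>" "x \<in> N"
  shows "f (insert x S) \<le> 2 * opt"
proof -
  have "f ({x} \<union> S) \<le> f {x} + f S"
    using assms indep_subset by (intro objective_Un_le[OF objective]) auto
  then show ?thesis using le_opt[of S] le_opt[of "{x}"] assms singletons by auto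
qed

lemma finite_feasible: "finite (feasible N \<I> A)"
  using finite_N by (simp add: feasible_def)

lemma feasible_nonempty:
  assumes "A \<in> \<I>" "card A < r"
  shows "feasible N \<I> A \<noteq> {}"
proof -
  obtain T where T: "T \<in> \<I>" "card T = r"
    using matroid_rank_attained[OF matroid] rank by auto
  then obtain e where "e \<in> T - A" "insert e A \<in> \<I>"
    using matroid_augment[OF matroid assms(1) T(1)] assms by auto
  then show ?thesis using indep_subset[OF T(1)] by (auto simp: feasible_def)
qed

lemma greedy_step_indep:
  assumes "A \<in> \<I>" "card A < r"
  shows "greedy_step N \<I> X v A \<in> \<I>" and "card (greedy_step N \<I> X v A) = Suc (card A)"
  using best_in(1)[OF finite_feasible feasible_nonempty[OF assms]] indep_finite[OF assms(1)]
  by (auto simp: greedy_step_def feasible_def)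

lemma greedy_0: "greedy N \<I> X v 0 = {}" and
  greedy_Suc: "greedy N \<I> X v (Suc i) = greedy_step N \<I> X v (greedy N \<I> X v i)"
  by (simp_all add: greedy_def)

lemma greedy_indep: "i \<le> r \<Longrightarrow> greedy N \<I> X v i \<in> \<I> \<and> card (greedy N \<I> X v i) = i"
proof (induction i)
  case 0
  then show ?case using matroid by (simp add: greedy_0 matroid_def)
next
  case (Suc i)
  then show ?case using greedy_step_indep[of "greedy N \<I> X v i"] by (simp add: greedy_Suc)
qed

lemma step_queries_card:
  assumes "A \<in> \<I>" "S \<in> step_queries N \<I> X A"
  shows "S \<subseteq> N" and "card S \<le> card A + 2"
proof -
  obtain e x where S: "S = insert x (insert e A)" "e \<in> N" "x \<in> X"
    using assms by (auto simp: step_queries_def feasible_def)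
  then show "S \<subseteq> N" using X indep_subset[OF assms(1)] by auto
  show "card S \<le> card A + 2"
    unfolding S using indep_finite[OF assms(1)]
    by (metis add_2_eq_Suc' card_insert_if finite_insert le_SucI le_refl)
qed

text \<open>The set after \<open>i\<close> steps is chosen by scores of sets with \<open>i\<close>
  elements, and these scores read sets with one element more; hence \<open>Suc i\<close>.\<close>

lemma greedy_cong:
  assumes "\<And>S. S \<subseteq> N \<Longrightarrow> card S \<le> Suc i \<Longrightarrow> v S = v' S" and "i \<le> r"
  shows "greedy N \<I> X v i = greedy N \<I> X v' i"
  using assms
proof (induction i)
  case 0
  then show ?case by (simp add: greedy_0)
next
  case (Suc i)
  have IH: "greedy N \<I> X v i = greedy N \<I> X v' i"
    using Suc by simp
  have "greedy_step N \<I> X v (greedy N \<I> X v' i) = greedy_step N \<I> X v' (greedy N \<I> X v' i)"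
    using Suc.prems greedy_indep[of i v'] step_queries_card[of "greedy N \<I> X v' i"]
    by (intro greedy_step_cong) fastforce
  then show ?case by (simp add: greedy_Suc IH)
qed

lemma measurable_obs:
  assumes "S \<in> J"
  shows "(\<lambda>\<omega>. obs \<omega> S) \<in> borel_measurable (Pi\<^sub>M J (\<lambda>_. D))"
  using measurable_coordinate[OF assms] by measurable

lemma measurable_neighbour_score:
  assumes "\<And>x. x \<in> X - S \<Longrightarrow> insert x S \<in> J"
  shows "(\<lambda>\<omega>. neighbour_score X (obs \<omega>) S) \<in> borel_measurable (Pi\<^sub>M J (\<lambda>_. D))"
  unfolding neighbour_score_def
  by (intro borel_measurable_sum borel_measurable_max borel_measurable_const measurable_obs assms)

lemma measurable_removal_score:
  assumes "\<And>y. y \<in> S \<Longrightarrow> S - {y} \<in> J"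
  shows "(\<lambda>\<omega>. removal_score (obs \<omega>) S) \<in> borel_measurable (Pi\<^sub>M J (\<lambda>_. D))"
  unfolding removal_score_def
  by (intro borel_measurable_sum borel_measurable_max borel_measurable_const measurable_obs assms)

text \<open>Stated for any block \<open>J\<close> of coordinates containing the sets read, so that
  the event of reaching a given set belongs to the sigma-algebra of \<open>J\<close>. The step case
  splits over the finitely many sets reached before.\<close>

lemma measurable_greedy:
  assumes "\<And>S. S \<subseteq> N \<Longrightarrow> card S \<le> Suc i \<Longrightarrow> S \<in> J" and "i \<le> r"
  shows "(\<lambda>\<omega>. greedy N \<I> X (obs \<omega>) i) \<in>
    measurable (Pi\<^sub>M J (\<lambda>_. D)) (count_space {A\<in>\<I>. card A = i})"
  using assms
proof (induction i)
  case 0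
  then show ?case using matroid by (simp add: greedy_0 matroid_def)
next
  case (Suc i)
  let ?M = "Pi\<^sub>M J (\<lambda>_. D)"
  have IH: "(\<lambda>\<omega>. greedy N \<I> X (obs \<omega>) i) \<in> measurable ?M (count_space {A\<in>\<I>. card A = i})"
    using Suc by simp
  have "(\<lambda>\<omega>. greedy_step N \<I> X (obs \<omega>) A) \<in> measurable ?M (count_space {A\<in>\<I>. card A = Suc i})"
    if A: "A \<in> {A\<in>\<I>. card A = i}" for A
  proof -
    have "(\<lambda>\<omega>. best (\<lambda>e. neighbour_score X (obs \<omega>) (insert e A)) (feasible N \<I> A))
        \<in> measurable ?M (count_space UNIV)"
    proof (intro measurable_best finite_feasible measurable_neighbour_score)
      fix e x assume "e \<in> feasible N \<I> A" "x \<in> X - insert e A"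
      then have "insert x (insert e A) \<in> step_queries N \<I> X A"
        by (auto simp: step_queries_def)
      then show "insert x (insert e A) \<in> J"
        using step_queries_card[of A "insert x (insert e A)"] A Suc.prems(1) by simp
    qed
    then have "(\<lambda>\<omega>. greedy_step N \<I> X (obs \<omega>) A) \<in> measurable ?M (count_space UNIV)"
      unfolding greedy_step_def by (rule measurable_compose) simp
    moreover have "greedy_step N \<I> X (obs \<omega>) A \<in> {A\<in>\<I>. card A = Suc i}" for \<omega>
      using greedy_step_indep[of A] A Suc.prems by auto
    ultimately show ?thesis
      using finite_indep by (auto simp: measurable_count_space_eq_countable countable_finite)
  qed
  then show ?case
    unfolding greedy_Suc
    by (rule measurable_compose_countable'[OF _ IH]) (use finite_indep in \<open>auto intro: countable_finite\<close>)
qed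

definition deviates :: "real \<Rightarrow> real \<Rightarrow> 'a set \<Rightarrow> ('a set \<Rightarrow> real) \<Rightarrow> bool" where
  "deviates \<kappa> t S \<xi> \<longleftrightarrow> \<bar>neighbour_score X (obs \<xi>) S - \<kappa> * (\<Sum>x\<in>X - S. f (insert x S))\<bar> \<ge> t"

definition removal_deviates :: "real \<Rightarrow> real \<Rightarrow> 'a set \<Rightarrow> ('a set \<Rightarrow> real) \<Rightarrow> bool" where
  "removal_deviates \<kappa> t S \<xi> \<longleftrightarrow> \<bar>removal_score (obs \<xi>) S - \<kappa> * (\<Sum>y\<in>S. f (S - {y}))\<bar> \<ge> t"

definition greedy_deviates :: "real \<Rightarrow> real \<Rightarrow> nat \<Rightarrow> ('a set \<Rightarrow> real) \<Rightarrow> bool" where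
  "greedy_deviates \<kappa> t i \<xi> \<longleftrightarrow> (\<exists>e\<in>feasible N \<I> (greedy N \<I> X (obs \<xi>) i).
      deviates \<kappa> t (insert e (greedy N \<I> X (obs \<xi>) i)) \<xi>)"

text \<open>Here \<open>S\<close> is fixed in advance, so concentration applies directly. Enlarging
  \<open>card (X - S)\<close> to \<open>card X\<close> makes the bound independent of
  \<open>S\<close>; if \<open>X - S\<close> is empty, the score and its target are both 0.\<close>

lemma prob_deviates:
  assumes S: "S \<in> \<I>" and "opt > 0" "B > 0" "t > 0"
  shows "noise.prob {\<xi>\<in>space \<Omega>. deviates (clipped_mean D B) t S \<xi>}
    \<le> 2 * exp (- 2 * t\<^sup>2 / (real (card X) * (B * (2 * opt))\<^sup>2)) + real (card X) * measure D {B<..}"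
proof (cases "X - S = {}")
  case True
  then show ?thesis using \<open>t > 0\<close> unfolding deviates_def neighbour_score_def True by simp
next
  case False
  define \<S> where "\<S> = (\<lambda>x. insert x S) ` (X - S)"
  have inj: "inj_on (\<lambda>x. insert x S) (X - S)"
    by (auto simp: inj_on_def)
  have fin: "finite (X - S)" using finite_X by simp
  have card: "card \<S> = card (X - S)" "card (X - S) \<le> card X" "card (X - S) > 0"
    using inj fin finite_X False by (auto simp: \<S>_def card_image card_mono card_gt_0_iff)
  have SN: "\<S> \<subseteq> Pow N"
    using X indep_subset[OF S] by (auto simp: \<S>_def)
  have w: "0 \<le> f T \<and> f T \<le> 2 * opt" if T: "T \<in> \<S>" for T
  proof -
    have "0 \<le> f T" using T SN by (intro objective_nonneg[OF objective]) auto
    moreover have "f T \<le> 2 * opt" using T insert_le_opt[OF S] X by (auto simp: \<S>_def)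
    ultimately show ?thesis ..
  qed
  have W: "2 * opt > 0" using \<open>opt > 0\<close> by simp
  have "{\<xi>\<in>space \<Omega>. deviates (clipped_mean D B) t S \<xi>} =
      {\<xi>\<in>space \<Omega>. \<bar>(\<Sum>T\<in>\<S>. max 0 (\<xi> T * f T)) - clipped_mean D B * (\<Sum>T\<in>\<S>. f T)\<bar> \<ge> t}"
    by (simp add: deviates_def neighbour_score_def \<S>_def sum.reindex[OF inj])
  also have "noise.prob \<dots> \<le> 2 * exp (- 2 * t\<^sup>2 / (real (card \<S>) * (B * (2 * opt))\<^sup>2))
      + real (card \<S>) * measure D {B<..}"
    by (rule clipped_sum_concentration[OF SN w W \<open>B > 0\<close> \<open>t > 0\<close>])
  also have "\<dots> \<le> 2 * exp (- 2 * t\<^sup>2 / (real (card X) * (B * (2 * opt))\<^sup>2)) + real (card X) * measure D {B<..}"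
  proof -
    have "2 * t\<^sup>2 / (real (card X) * (B * (2 * opt))\<^sup>2) \<le> 2 * t\<^sup>2 / (real (card \<S>) * (B * (2 * opt))\<^sup>2)"
      using card assms by (intro divide_left_mono mult_right_mono mult_pos_pos) auto
    then show ?thesis
      using card by (intro add_mono mult_left_mono mult_right_mono) auto
  qed
  finally show ?thesis .
qed

lemma prob_removal_deviates:
  assumes S: "S \<in> \<I>" "card S = r" and "opt > 0" "B > 0" "t > 0"
  shows "noise.prob {\<xi>\<in>space \<Omega>. removal_deviates (clipped_mean D B) t S \<xi>}
    \<le> 2 * exp (- 2 * t\<^sup>2 / (real r * (B * opt)\<^sup>2)) + real r * measure D {B<..}"
proof -
  define \<S> where "\<S> = (\<lambda>y. S - {y}) ` S"
  have inj: "inj_on (\<lambda>y. S - {y}) S"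
    by (auto simp: inj_on_def)
  have card: "card \<S> = r"
    using inj S by (simp add: \<S>_def card_image)
  have SN: "\<S> \<subseteq> Pow N"
    using indep_subset[OF S(1)] by (auto simp: \<S>_def)
  have w: "0 \<le> f T \<and> f T \<le> opt" if T: "T \<in> \<S>" for T
  proof -
    have "0 \<le> f T" using T SN by (intro objective_nonneg[OF objective]) auto
    moreover have "T \<in> \<I>" using T S matroid by (auto simp: \<S>_def matroid_def)
    ultimately show ?thesis using le_opt by auto
  qed
  have "{\<xi>\<in>space \<Omega>. removal_deviates (clipped_mean D B) t S \<xi>} =
      {\<xi>\<in>space \<Omega>. \<bar>(\<Sum>T\<in>\<S>. max 0 (\<xi> T * f T)) - clipped_mean D B * (\<Sum>T\<in>\<S>. f T)\<bar> \<ge> t}"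
    by (simp add: removal_deviates_def removal_score_def \<S>_def sum.reindex[OF inj])
  then show ?thesis
    using clipped_sum_concentration[OF SN w \<open>opt > 0\<close> \<open>B > 0\<close> \<open>t > 0\<close>] by (simp add: card)
qed

lemma sets_deviates:
  assumes "\<And>x. x \<in> X - S \<Longrightarrow> insert x S \<in> J"
  shows "{\<omega>\<in>space (Pi\<^sub>M J (\<lambda>_. D)). deviates \<kappa> t S \<omega>} \<in> sets (Pi\<^sub>M J (\<lambda>_. D))"
  unfolding deviates_def using measurable_neighbour_score[OF assms] by measurable

lemma deviates_restrict:
  assumes "\<And>x. x \<in> X - S \<Longrightarrow> insert x S \<in> J"
  shows "deviates \<kappa> t S (restrict \<xi> J) = deviates \<kappa> t S \<xi>"
proof -
  have "neighbour_score X (obs (restrict \<xi> J)) S = neighbour_score X (obs \<xi>) S"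
    unfolding neighbour_score_def by (intro sum.cong) (use assms in auto)
  then show ?thesis by (simp add: deviates_def)
qed

text \<open>
  Whatever set the greedy procedure has reached after \<open>i\<close> steps was chosen by looking at sets of
  cardinality at most \<open>i + 1\<close>, whereas the next scores are sums over sets of cardinality \<open>i + 2\<close>.
  So no union bound over all reachable sets is needed.
\<close>

lemma prob_greedy_step_deviates:
  assumes "i < r" and p: "\<And>S. S \<in> \<I> \<Longrightarrow> noise.prob {\<xi>\<in>space \<Omega>. deviates \<kappa> t S \<xi>} \<le> p"
  shows "{\<xi>\<in>space \<Omega>. greedy_deviates \<kappa> t i \<xi>} \<in> sets \<Omega>" (is "?E \<in> _")
    and "noise.prob {\<xi>\<in>space \<Omega>. greedy_deviates \<kappa> t i \<xi>} \<le> real (card N) * p"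
proof -
  have p0: "p \<ge> 0"
    using order_trans[OF measure_nonneg p[of "{}"]] matroid by (simp add: matroid_def)
  \<comment> \<open>\<open>J\<close> determines the set \<open>A\<close> that is reached.
    \<open>J'\<close> carries the scores of its extensions, which read \<open>A\<close> together
    with \<open>e\<close> and an \<open>x\<close> outside \<open>insert e A\<close>, that is
    \<open>i + 2\<close> elements.\<close>
  define J where "J = {S. S \<subseteq> N \<and> card S \<le> Suc i}"
  define J' where "J' = {S. S \<subseteq> N \<and> card S = Suc (Suc i)}"
  define \<A> where "\<A> = {A\<in>\<I>. card A = i}"
  have fin: "finite \<A>" using finite_indep by (simp add: \<A>_def)
  have JN: "J \<inter> J' = {}" "J \<subseteq> Pow N" "J' \<subseteq> Pow N"
    by (auto simp: J_def J'_def)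
  define H where "H A = {\<omega>\<in>space (Pi\<^sub>M J (\<lambda>_. D)). greedy N \<I> X (obs \<omega>) i = A}" for A
  define H' where "H' A = {\<omega>\<in>space (Pi\<^sub>M J' (\<lambda>_. D)). \<exists>e\<in>feasible N \<I> A. deviates \<kappa> t (insert e A) \<omega>}" for A
  let ?at = "\<lambda>A. {\<xi>\<in>space \<Omega>. greedy N \<I> X (obs \<xi>) i = A}"
  let ?dev = "\<lambda>A. {\<xi>\<in>space \<Omega>. \<exists>e\<in>feasible N \<I> A. deviates \<kappa> t (insert e A) \<xi>}"
  have gm: "(\<lambda>\<omega>. greedy N \<I> X (obs \<omega>) i) \<in> measurable (Pi\<^sub>M J (\<lambda>_. D)) (count_space \<A>)"
    unfolding \<A>_def using \<open>i < r\<close> by (intro measurable_greedy) (auto simp: J_def)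
  have gm': "(\<lambda>\<omega>. greedy N \<I> X (obs \<omega>) i) \<in> measurable \<Omega> (count_space \<A>)"
    unfolding \<A>_def noise_space_def using \<open>i < r\<close> by (intro measurable_greedy) auto
  have next_in: "insert x (insert e A) \<in> J'" if "A \<in> \<A>" "e \<in> feasible N \<I> A" "x \<in> X - insert e A" for A e x
  proof -
    have "A \<subseteq> N" "finite A" using that indep_subset indep_finite by (auto simp: \<A>_def)
    then show ?thesis using that X by (auto simp: J'_def feasible_def \<A>_def)
  qed
  have sets_H: "H A \<in> sets (Pi\<^sub>M J (\<lambda>_. D))" if "A \<in> \<A>" for A
    using measurable_sets[OF gm, of "{A}"] that by (simp add: H_def vimage_def Int_def conj_commute)
  have sets_at: "?at A \<in> sets \<Omega>" if "A \<in> \<A>" for A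
    using measurable_sets[OF gm', of "{A}"] that by (simp add: vimage_def Int_def conj_commute)
  have sets_H': "H' A \<in> sets (Pi\<^sub>M J' (\<lambda>_. D))" if "A \<in> \<A>" for A
  proof -
    have "H' A = (\<Union>e\<in>feasible N \<I> A. {\<omega>\<in>space (Pi\<^sub>M J' (\<lambda>_. D)). deviates \<kappa> t (insert e A) \<omega>})"
      by (auto simp: H'_def)
    also have "\<dots> \<in> sets (Pi\<^sub>M J' (\<lambda>_. D))"
      using that next_in by (intro sets.finite_UN finite_feasible sets_deviates) auto
    finally show ?thesis .
  qed
  have restrict_space: "restrict \<xi> K \<in> space (Pi\<^sub>M K (\<lambda>_. D))" if "\<xi> \<in> space \<Omega>" "K \<subseteq> Pow N" for \<xi> K
    using that by (auto simp: noise_space_def space_PiM PiE_iff)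
  have at_eq: "?at A = {\<xi>\<in>space \<Omega>. restrict \<xi> J \<in> H A}" for A
  proof -
    have "greedy N \<I> X (obs (restrict \<xi> J)) i = greedy N \<I> X (obs \<xi>) i" for \<xi>
      using \<open>i < r\<close> by (intro greedy_cong) (auto simp: J_def)
    then show ?thesis using restrict_space[OF _ JN(2)] by (auto simp: H_def)
  qed
  have dev_eq: "?dev A = {\<xi>\<in>space \<Omega>. restrict \<xi> J' \<in> H' A}" if "A \<in> \<A>" for A
    using restrict_space[OF _ JN(3)] deviates_restrict[of "insert _ A" J'] next_in[OF that]
    by (auto simp: H'_def)
  have dev_prob: "noise.prob (?dev A) \<le> real (card N) * p" if "A \<in> \<A>" for A
  proof -
    have "?dev A = (\<Union>e\<in>feasible N \<I> A. {\<xi>\<in>space \<Omega>. deviates \<kappa> t (insert e A) \<xi>})"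
      by auto
    also have "noise.prob \<dots> \<le> (\<Sum>e\<in>feasible N \<I> A. noise.prob {\<xi>\<in>space \<Omega>. deviates \<kappa> t (insert e A) \<xi>})"
    proof (intro measure_UNION_le finite_feasible)
      fix e assume e: "e \<in> feasible N \<I> A"
      show "{\<xi>\<in>space \<Omega>. deviates \<kappa> t (insert e A) \<xi>} \<in> sets \<Omega>"
        unfolding noise_space_def using next_in[OF that e] JN by (intro sets_deviates) blast
    qed
    also have "\<dots> \<le> (\<Sum>e\<in>feasible N \<I> A. p)"
      by (intro sum_mono p) (auto simp: feasible_def)
    also have "\<dots> \<le> real (card N) * p"
    proof -
      have "card (feasible N \<I> A) \<le> card N"
        using finite_N by (auto simp: feasible_def intro!: card_mono)
      then show ?thesis using p0 by (simp add: mult_right_mono)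
    qed
    finally show ?thesis .
  qed
  have joint: "noise.prob (?at A \<inter> ?dev A) \<le> noise.prob (?at A) * (real (card N) * p)" if "A \<in> \<A>" for A
  proof -
    have "noise.prob (?at A \<inter> ?dev A) = noise.prob (?at A) * noise.prob (?dev A)"
      using prob_disjoint_coordinates[OF JN sets_H[OF that] sets_H'[OF that]]
      unfolding at_eq dev_eq[OF that] by (simp add: Int_def conj_ac)
    then show ?thesis using dev_prob[OF that] by (simp add: mult_left_mono)
  qed
  have sets_dev: "?dev A \<in> sets \<Omega>" if "A \<in> \<A>" for A
  proof -
    have "?dev A = (\<Union>e\<in>feasible N \<I> A. {\<xi>\<in>space \<Omega>. deviates \<kappa> t (insert e A) \<xi>})"
      by auto
    also have "\<dots> \<in> sets \<Omega>"
      unfolding noise_space_def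
      using that next_in JN by (intro sets.finite_UN finite_feasible sets_deviates) blast
    finally show ?thesis .
  qed
  have E_eq: "?E = (\<Union>A\<in>\<A>. ?at A \<inter> ?dev A)"
    using measurable_space[OF gm'] by (auto simp: greedy_deviates_def)
  show "?E \<in> sets \<Omega>"
    unfolding E_eq using sets_at sets_dev fin by (intro sets.finite_UN sets.Int) auto
  have "noise.prob ?E \<le> (\<Sum>A\<in>\<A>. noise.prob (?at A \<inter> ?dev A))"
    unfolding E_eq using sets_at sets_dev fin by (intro measure_UNION_le) auto
  also have "\<dots> \<le> (\<Sum>A\<in>\<A>. noise.prob (?at A) * (real (card N) * p))"
    by (intro sum_mono joint)
  also have "\<dots> = (\<Sum>A\<in>\<A>. noise.prob (?at A)) * (real (card N) * p)"
    by (simp add: sum_distrib_right)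
  \<comment> \<open>The events of reaching different sets are disjoint, so their probabilities add
    up to at most 1.\<close>
  also have "\<dots> \<le> 1 * (real (card N) * p)"
  proof (rule mult_right_mono)
    have "(\<Sum>A\<in>\<A>. noise.prob (?at A)) = noise.prob (\<Union>A\<in>\<A>. ?at A)"
      using sets_at fin by (intro noise.finite_measure_finite_Union[symmetric]) (auto simp: disjoint_family_on_def)
    then show "(\<Sum>A\<in>\<A>. noise.prob (?at A)) \<le> 1" by simp
    show "0 \<le> real (card N) * p"
      using p0 by simp
  qed
  finally show "noise.prob ?E \<le> real (card N) * p" by simp
qed

end

subsection \<open>Quality of the output\<close>

lemma prob_replicate_pmf_avoid:
  "measure_pmf.prob (replicate_pmf k p) {l. set l \<inter> Y = {}} = measure_pmf.prob p (- Y) ^ k"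
proof (induction k)
  case 0
  then show ?case by (simp add: measure_return_pmf)
next
  case (Suc k)
  let ?F = "{l. set l \<inter> Y = {}}"
  have "replicate_pmf (Suc k) p = map_pmf (\<lambda>(x, l). x # l) (pair_pmf p (replicate_pmf k p))"
    by (simp add: pair_pmf_def map_bind_pmf map_pmf_def bind_assoc_pmf bind_return_pmf)
  then have "measure_pmf.prob (replicate_pmf (Suc k) p) ?F =
      measure_pmf.prob (pair_pmf p (replicate_pmf k p)) ((\<lambda>(x, l). x # l) -` ?F)"
    by simp
  also have "(\<lambda>(x, l). x # l) -` ?F = (- Y) \<times> ?F"
    by auto
  also have "measure_pmf.prob (pair_pmf p (replicate_pmf k p)) ((- Y) \<times> ?F) =
      measure_pmf.prob (pair_pmf p (replicate_pmf k p)) (((- Y) \<inter> set_pmf p) \<times> (?F \<inter> set_pmf (replicate_pmf k p)))"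
    by (subst measure_Int_set_pmf[symmetric]) (auto intro!: arg_cong[where f = "measure_pmf.prob _"])
  also have "\<dots> = measure_pmf.prob p (- Y) * measure_pmf.prob (replicate_pmf k p) ?F"
    by (subst measure_pmf_prob_product) (auto simp: measure_Int_set_pmf)
  finally show ?case using Suc by simp
qed

context noisy_instance
begin

section \<open>Deterministic guarantees when no score deviates\<close>

lemma opt_nonneg: "opt \<ge> 0"
  using le_opt[of "{}"] objective_empty[OF objective] matroid by (simp add: matroid_def)

lemma smoothed_omitted:
  assumes "S \<in> \<I>"
  shows "(\<Sum>x\<in>X - S. f (insert x S)) \<le> smoothed X f S"
    and "smoothed X f S \<le> (\<Sum>x\<in>X - S. f (insert x S)) + real r * opt"
proof -
  have "smoothed X f S = (\<Sum>x\<in>X - S. f (insert x S)) + (\<Sum>x\<in>X \<inter> S. f (insert x S))"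
    unfolding smoothed_def using sum.Int_Diff[OF finite_X, of _ S] by (simp add: add.commute)
  also have "(\<Sum>x\<in>X \<inter> S. f (insert x S)) = real (card (X \<inter> S)) * f S"
    by (simp add: insert_absorb)
  finally have eq: "smoothed X f S = (\<Sum>x\<in>X - S. f (insert x S)) + real (card (X \<inter> S)) * f S" .
  have f0: "0 \<le> f S"
    using assms indep_subset by (intro objective_nonneg[OF objective])
  then show "(\<Sum>x\<in>X - S. f (insert x S)) \<le> smoothed X f S"
    by (simp add: eq)
  have "card (X \<inter> S) \<le> card S"
    using indep_finite[OF assms] by (intro card_mono) auto
  also have "\<dots> \<le> r"
    using matroid_card_le_rank[OF matroid assms] rank by simp
  finally have "real (card (X \<inter> S)) * f S \<le> real r * opt"
    using le_opt[OF assms] f0 by (intro mult_mono) auto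
  then show "smoothed X f S \<le> (\<Sum>x\<in>X - S. f (insert x S)) + real r * opt"
    by (simp add: eq)
qed

text \<open>Two errors of size \<open>\<kappa> * t\<close> each: the noise, and the skipped terms
  with \<open>x\<close> in \<open>S\<close>, at most \<open>r\<close> of them worth at most
  \<open>opt\<close> each. The latter is why \<open>t\<close> has to be at least
  \<open>r * opt\<close>.\<close>

lemma neighbour_score_close:
  assumes S: "S \<in> \<I>" and "\<kappa> > 0" and t: "real r * opt \<le> t" and "\<not> deviates \<kappa> (\<kappa> * t) S \<xi>"
  shows "\<bar>neighbour_score X (obs \<xi>) S - \<kappa> * smoothed X f S\<bar> \<le> \<kappa> * (2 * t)"
proof -
  let ?s = "\<Sum>x\<in>X - S. f (insert x S)"
  have "\<bar>smoothed X f S - ?s\<bar> \<le> t"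
    using smoothed_omitted[OF S] t by simp
  then have "\<kappa> * \<bar>smoothed X f S - ?s\<bar> \<le> \<kappa> * t"
    using \<open>\<kappa> > 0\<close> by (intro mult_left_mono) auto
  then have "\<bar>\<kappa> * smoothed X f S - \<kappa> * ?s\<bar> \<le> \<kappa> * t"
    using \<open>\<kappa> > 0\<close> by (metis abs_mult abs_of_pos right_diff_distrib)
  moreover have "\<bar>neighbour_score X (obs \<xi>) S - \<kappa> * ?s\<bar> < \<kappa> * t"
    using assms(4) by (simp add: deviates_def)
  ultimately show ?thesis by (simp add: algebra_simps)
qed

text \<open>A greedy step compares two scores that are each off by at most
  \<open>\<kappa> * (2 * t)\<close>, so it loses at most \<open>4 * t\<close>; \<open>t\<close> is
  chosen so that \<open>r\<close> such losses add up to
  \<open>2 * \<delta> * m * opt\<close>.\<close>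

lemma greedy_guarantee:
  fixes \<delta> :: real
  defines "m \<equiv> real (card X)" and "t \<equiv> \<delta> * real (card X) * opt / (2 * real r)"
  assumes "r > 0" "\<kappa> > 0" "\<delta> \<ge> 0" and t: "real r * opt \<le> t"
    and empty: "\<not> deviates \<kappa> (\<kappa> * t) {} \<xi>"
    and steps: "\<And>i. i < r \<Longrightarrow> \<not> greedy_deviates \<kappa> (\<kappa> * t) i \<xi>"
  defines "A \<equiv> greedy N \<I> X (obs \<xi>) r"
  shows "m * opt \<le> 2 * smoothed X f A - smoothed X f {} + 2 * \<delta> * m * opt"
    and "\<bar>neighbour_score X (obs \<xi>) A - \<kappa> * smoothed X f A\<bar> \<le> \<kappa> * (\<delta> * m * opt)"
    and "\<bar>neighbour_score X (obs \<xi>) {} - \<kappa> * smoothed X f {}\<bar> \<le> \<kappa> * (\<delta> * m * opt)"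
proof -
  let ?A = "\<lambda>i. greedy N \<I> X (obs \<xi>) i"
  let ?score = "neighbour_score X (obs \<xi>)"
  have r1: "real r \<ge> 1" using \<open>r > 0\<close> by simp
  have t_le: "2 * t \<le> \<delta> * m * opt"
  proof -
    have "\<delta> * m * opt / real r \<le> \<delta> * m * opt / 1"
      using r1 \<open>\<delta> \<ge> 0\<close> opt_nonneg by (intro divide_left_mono) (auto simp: m_def)
    then show ?thesis by (simp add: t_def m_def)
  qed
  have t0: "t \<ge> 0" using \<open>\<delta> \<ge> 0\<close> opt_nonneg by (simp add: t_def)
  have close: "\<bar>?score (insert e (?A i)) - \<kappa> * smoothed X f (insert e (?A i))\<bar> \<le> \<kappa> * (2 * t)"
    if "i < r" "e \<in> feasible N \<I> (?A i)" for i e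
    using that steps[OF that(1)]
    by (intro neighbour_score_close[OF _ \<open>\<kappa> > 0\<close> t]) (auto simp: feasible_def greedy_deviates_def)
  have chosen: "\<exists>e\<in>feasible N \<I> (?A i). ?A (Suc i) = insert e (?A i) \<and>
      (\<forall>e'\<in>feasible N \<I> (?A i). ?score (insert e' (?A i)) \<le> ?score (?A (Suc i)))" if "i < r" for i
  proof -
    have "feasible N \<I> (?A i) \<noteq> {}"
      using greedy_indep[of i] that by (intro feasible_nonempty) auto
    from best_in[OF finite_feasible this, where h = "\<lambda>e. ?score (insert e (?A i))"] show ?thesis
      by (auto simp: greedy_Suc greedy_step_def)
  qed
  have greedy: "smoothed X f (insert e (?A i)) \<le> smoothed X f (?A (Suc i)) + 4 * t"
    if i: "i < r" and "e \<in> N - ?A i" "insert e (?A i) \<in> \<I>" for i e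
  proof -
    have e: "e \<in> feasible N \<I> (?A i)" using that by (simp add: feasible_def)
    obtain e' where e': "e' \<in> feasible N \<I> (?A i)" "?A (Suc i) = insert e' (?A i)"
      "?score (insert e (?A i)) \<le> ?score (?A (Suc i))"
      using chosen[OF i] e by blast
    have "\<kappa> * smoothed X f (insert e (?A i)) \<le> \<kappa> * (smoothed X f (?A (Suc i)) + 4 * t)"
      using close[OF i e] close[OF i e'(1)] e'(2,3) by (simp add: abs_le_iff algebra_simps)
    then show ?thesis using \<open>\<kappa> > 0\<close> by simp
  qed
  obtain Q where Q: "Q \<in> \<I>" "f Q = opt" using opt_attained by blast
  have chain: "?A i \<subseteq> ?A (Suc i)" if "i < r" for i
    using chosen[OF that] by blast
  have "smoothed X f (A \<union> Q) \<le> 2 * smoothed X f A - smoothed X f {} + real r * (4 * t)"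
    unfolding A_def
    by (rule approximate_greedy_bound[OF objective matroid X _ greedy_indep chain greedy Q(1)])
      (use t0 matroid_card_le_rank[OF matroid Q(1)] rank in auto)
  moreover have "real r * (4 * t) = 2 * \<delta> * m * opt"
    using \<open>r > 0\<close> by (simp add: t_def m_def)
  moreover have "m * opt \<le> smoothed X f (A \<union> Q)"
  proof -
    have "A \<subseteq> N" using greedy_indep[of r "obs \<xi>"] indep_subset by (simp add: A_def)
    then have "opt \<le> f (insert x (A \<union> Q))" if "x \<in> X" for x
      using that X indep_subset[OF Q(1)] Q(2) objective_mono[OF objective, of Q "insert x (A \<union> Q)"] by auto
    then have "(\<Sum>x\<in>X. opt) \<le> smoothed X f (A \<union> Q)"
      unfolding smoothed_def by (rule sum_mono)
    then show ?thesis by (simp add: m_def)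
  qed
  ultimately show "m * opt \<le> 2 * smoothed X f A - smoothed X f {} + 2 * \<delta> * m * opt"
    by linarith
  have bound: "\<kappa> * (2 * t) \<le> \<kappa> * (\<delta> * m * opt)"
    using t_le \<open>\<kappa> > 0\<close> by (intro mult_left_mono) auto
  \<comment> \<open>The score of \<open>A\<close> was among those compared in the last step, so the
    event for that step already controls it.\<close>
  obtain j where j: "r = Suc j" using \<open>r > 0\<close> by (cases r) auto
  obtain e where "e \<in> feasible N \<I> (?A j)" "A = insert e (?A j)"
    using chosen[of j] j by (auto simp: A_def)
  then show "\<bar>?score A - \<kappa> * smoothed X f A\<bar> \<le> \<kappa> * (\<delta> * m * opt)"
    using close[of j e] j bound by simp
  show "\<bar>?score {} - \<kappa> * smoothed X f {}\<bar> \<le> \<kappa> * (\<delta> * m * opt)"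
    using neighbour_score_close[OF _ \<open>\<kappa> > 0\<close> t empty] matroid bound by (simp add: matroid_def)
qed

lemma base_of_base:
  assumes "x \<in> N"
  shows "base_of \<I> r x \<in> \<I>" and "x \<in> base_of \<I> r x" and "card (base_of \<I> r x) = r"
proof -
  have "\<exists>S. S \<in> \<I> \<and> x \<in> S \<and> card S = r"
    using matroid_extend_to_rank[OF matroid, of "{x}"] assms singletons rank by auto
  then have "base_of \<I> r x \<in> \<I> \<and> x \<in> base_of \<I> r x \<and> card (base_of \<I> r x) = r"
    unfolding base_of_def by (rule someI_ex)
  then show "base_of \<I> r x \<in> \<I>" and "x \<in> base_of \<I> r x" and "card (base_of \<I> r x) = r"
    by auto
qed

text \<open>The chosen base is compared with the base through \<open>z\<close> by their removal
  sums: the latter has sum at least \<open>(real r - 1) * f {z}\<close>, the former at most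
  \<open>real r * f S\<close>, and the two estimates lose \<open>\<delta> * real r * opt\<close>
  each.\<close>

lemma best_base_guarantee:
  assumes Z: "Z \<subseteq> N" "z \<in> Z" and "r > 0" "\<kappa> > 0"
    and good: "\<And>x. x \<in> Z \<Longrightarrow> \<not> removal_deviates \<kappa> (\<kappa> * (\<delta> * real r * opt)) (base_of \<I> r x) \<xi>"
  defines "S \<equiv> base_of \<I> r (best (\<lambda>x. removal_score (obs \<xi>) (base_of \<I> r x)) Z)"
  shows "(real r - 1) * f {z} - 2 * \<delta> * real r * opt \<le> real r * f S" and "S \<in> \<I>"
proof -
  let ?H = "\<lambda>S. \<Sum>y\<in>S. f (S - {y})"
  let ?b = "best (\<lambda>x. removal_score (obs \<xi>) (base_of \<I> r x)) Z"
  have "finite Z" using Z finite_N finite_subset by blast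
  then have b: "?b \<in> Z" "removal_score (obs \<xi>) (base_of \<I> r z) \<le> removal_score (obs \<xi>) S"
    unfolding S_def using best_in[of Z, where h = "\<lambda>x. removal_score (obs \<xi>) (base_of \<I> r x)"] Z(2)
    by (auto simp del: ball_simps)
  have bN: "?b \<in> N" "z \<in> N" using b Z by auto
  show SI: "S \<in> \<I>" using base_of_base(1)[OF bN(1)] by (simp add: S_def)
  let ?T = "base_of \<I> r z"
  have T: "?T \<in> \<I>" "z \<in> ?T" "card ?T = r" using base_of_base[OF bN(2)] by auto
  have "\<kappa> * ?H ?T - \<kappa> * (\<delta> * real r * opt) \<le> removal_score (obs \<xi>) ?T"
    using good[OF Z(2)] by (simp add: removal_deviates_def abs_le_iff not_le)
  also have "\<dots> \<le> removal_score (obs \<xi>) S" by (rule b(2))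
  also have "\<dots> \<le> \<kappa> * ?H S + \<kappa> * (\<delta> * real r * opt)"
    using good[OF b(1)] by (simp add: removal_deviates_def S_def[symmetric] abs_le_iff not_le)
  finally have "\<kappa> * ?H ?T \<le> \<kappa> * (?H S + 2 * \<delta> * real r * opt)"
    by (simp add: algebra_simps)
  then have "?H ?T \<le> ?H S + 2 * \<delta> * real r * opt"
    using \<open>\<kappa> > 0\<close> by simp
  moreover have "?H S \<le> real r * f S"
    using sum_removals_bounds(2)[OF objective indep_subset[OF SI] indep_finite[OF SI]]
      base_of_base(3)[OF bN(1)] by (simp add: S_def)
  moreover have "(real r - 1) * f ?T \<le> ?H ?T"
    using sum_removals_bounds(1)[OF objective indep_subset[OF T(1)] indep_finite[OF T(1)]] T(3) by simp
  moreover have "(real r - 1) * f {z} \<le> (real r - 1) * f ?T"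
    using T \<open>r > 0\<close> indep_subset[OF T(1)]
    by (intro mult_left_mono objective_mono[OF objective]) auto
  ultimately show "(real r - 1) * f {z} - 2 * \<delta> * real r * opt \<le> real r * f S"
    by linarith
qed

text \<open>A reverse Markov inequality: elements below \<open>c\<close> contribute at most
  \<open>c\<close>, the others at most \<open>opt\<close>. A large average over \<open>X\<close>
  thus forces many elements of value at least \<open>c\<close>.\<close>

lemma smoothed_empty_le:
  assumes "c \<ge> 0"
  shows "smoothed X f {} \<le> real (card {x\<in>X. f {x} \<ge> c}) * opt + real (card X) * c"
proof -
  let ?Y = "{x\<in>X. f {x} \<ge> c}"
  have "smoothed X f {} = (\<Sum>x\<in>?Y. f {x}) + (\<Sum>x\<in>X - ?Y. f {x})"
    unfolding smoothed_def using finite_X by (subst sum.subset_diff[of ?Y]) auto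
  also have "(\<Sum>x\<in>?Y. f {x}) \<le> real (card ?Y) * opt"
    using singletons X le_opt by (intro sum_bounded_above) auto
  also have "(\<Sum>x\<in>X - ?Y. f {x}) \<le> real (card (X - ?Y)) * c"
    by (intro sum_bounded_above) auto
  also have "real (card (X - ?Y)) * c \<le> real (card X) * c"
    using finite_X assms by (intro mult_right_mono) (auto intro: card_mono)
  finally show ?thesis by simp
qed

end

context noisy_instance
begin

abbreviation outcome :: "('a set \<Rightarrow> real) \<Rightarrow> 'a set \<Rightarrow> 'a set" where
  "outcome \<xi> Z \<equiv> decide \<I> r X (obs \<xi>) (greedy N \<I> X (obs \<xi>) r) Z"

lemma outcome_indep:
  assumes "Z \<subseteq> N" "Z \<noteq> {}"
  shows "outcome \<xi> Z \<in> \<I>"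
proof -
  have "finite Z" using assms finite_N finite_subset by blast
  then have "best (\<lambda>x. removal_score (obs \<xi>) (base_of \<I> r x)) Z \<in> N"
    using best_in(1)[of Z] assms by blast
  then show ?thesis
    using base_of_base(1) greedy_indep[of r "obs \<xi>"] by (simp add: decide_def)
qed

text \<open>With \<open>M = m * opt\<close> and estimation error \<open>M / 1000\<close>, the first
  case gives \<open>smoothed X f A - smoothed X f {}\<close> at least 0.331 M, the second gives
  \<open>smoothed X f {}\<close> at least 0.33 M. In the second case \<open>large\<close> supplies a
  \<open>z\<close>, and 13/40 - 2/1000 - (13/40)/1000 still exceeds 8/25.\<close>

lemma outcome_guarantee:
  assumes "r \<ge> 1000" and "\<kappa> > 0" "\<kappa>' > 0" and "X \<noteq> {}" and Z: "Z \<subseteq> N" "Z \<noteq> {}"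
    and t: "t = (1/1000) * real (card X) * opt / (2 * real r)" "real r * opt \<le> t"
    and empty: "\<not> deviates \<kappa> (\<kappa> * t) {} \<xi>"
    and steps: "\<And>i. i < r \<Longrightarrow> \<not> greedy_deviates \<kappa> (\<kappa> * t) i \<xi>"
    and removal: "\<And>x. x \<in> Z \<Longrightarrow> \<not> removal_deviates \<kappa>' (\<kappa>' * ((1/1000) * real r * opt)) (base_of \<I> r x) \<xi>"
    and large: "(\<exists>z\<in>Z. 13/40 * opt \<le> f {z}) \<or> smoothed X f {} < 33/100 * real (card X) * opt"
  shows "8/25 * opt \<le> f (outcome \<xi> Z)"
proof -
  define A where "A = greedy N \<I> X (obs \<xi>) r"
  define m where "m = real (card X)"
  define M where "M = m * opt"
  have m: "m > 0" using \<open>X \<noteq> {}\<close> finite_X by (simp add: m_def card_gt_0_iff)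
  have M0: "M \<ge> 0" using m opt_nonneg by (simp add: M_def)
  have r: "r > 0" using assms by simp
  note G = greedy_guarantee[OF r \<open>\<kappa> > 0\<close>, of "1/1000", folded t(1), OF _ t(2) empty steps, simplified, folded A_def m_def]
  have G1: "M \<le> 2 * smoothed X f A - smoothed X f {} + M / 500"
    using G(1) by (simp add: M_def)
  have G2: "\<bar>neighbour_score X (obs \<xi>) A - \<kappa> * smoothed X f A\<bar> \<le> \<kappa> * (M / 1000)"
    using G(2) by (simp add: M_def)
  have G3: "\<bar>neighbour_score X (obs \<xi>) {} - \<kappa> * smoothed X f {}\<bar> \<le> \<kappa> * (M / 1000)"
    using G(3) by (simp add: M_def)
  show ?thesis
  proof (cases "2 * neighbour_score X (obs \<xi>) {} \<le> neighbour_score X (obs \<xi>) A")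
    case True
    have "\<kappa> * (2 * smoothed X f {}) \<le> \<kappa> * (smoothed X f A + 3 * M / 1000)"
      using True G2 G3 unfolding abs_le_iff distrib_left by simp
    then have "2 * smoothed X f {} \<le> smoothed X f A + 3 * M / 1000"
      using \<open>\<kappa> > 0\<close> by simp
    moreover have "smoothed X f A \<le> smoothed X f {} + m * f A"
      unfolding m_def using greedy_indep[of r "obs \<xi>"] indep_subset
      by (intro smoothed_le[OF objective X]) (simp add: A_def)
    ultimately have "m * (8/25 * opt) \<le> m * f A"
      using G1 M0 by (simp add: M_def)
    then have "8/25 * opt \<le> f A" using m by simp
    then show ?thesis using True by (simp add: decide_def A_def)
  next
    case False
    have "\<kappa> * smoothed X f A \<le> \<kappa> * (2 * smoothed X f {} + 3 * M / 1000)"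
      using False G2 G3 unfolding abs_le_iff distrib_left by simp
    then have "smoothed X f A \<le> 2 * smoothed X f {} + 3 * M / 1000"
      using \<open>\<kappa> > 0\<close> by simp
    then have "33/100 * M \<le> smoothed X f {}"
      using G1 M0 by linarith
    then obtain z where z: "z \<in> Z" "13/40 * opt \<le> f {z}"
      using large by (auto simp: M_def m_def)
    define S where "S = base_of \<I> r (best (\<lambda>x. removal_score (obs \<xi>) (base_of \<I> r x)) Z)"
    have "(real r - 1) * f {z} - 2 * (1/1000) * real r * opt \<le> real r * f S"
      unfolding S_def by (rule best_base_guarantee(1)[OF Z(1) z(1) r \<open>\<kappa>' > 0\<close> removal])
    moreover have "(real r - 1) * (13/40 * opt) \<le> (real r - 1) * f {z}"
      using z r by (intro mult_left_mono) auto
    moreover have "1000 * opt \<le> real r * opt"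
      using \<open>r \<ge> 1000\<close> opt_nonneg by (intro mult_right_mono) auto
    moreover have "(real r - 1) * (13/40 * opt) = 13/40 * (real r * opt) - 13/40 * opt"
      "2 * (1/1000) * real r * opt = (real r * opt) / 500" "real r * (8/25 * opt) = 8/25 * (real r * opt)"
      by (simp_all add: field_simps)
    moreover have "real r * opt \<ge> 0" using opt_nonneg by simp
    ultimately have "real r * (8/25 * opt) \<le> real r * f S"
      by linarith
    then have "8/25 * opt \<le> f S" using r by simp
    then show ?thesis using False by (simp add: decide_def A_def S_def)
  qed
qed

text \<open>Guards against the value 0 that \<open>success_prob\<close> takes at nonmeasurable
  integrands. The greedy base has finitely many possible values, so it may be treated as
  fixed.\<close>

lemma measurable_outcome:
  assumes "Z \<subseteq> N"
  shows "(\<lambda>\<xi>. outcome \<xi> Z) \<in> measurable \<Omega> (count_space UNIV)"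
proof -
  have "finite Z" using assms finite_N finite_subset by blast
  have "(\<lambda>\<xi>. best (\<lambda>x. removal_score (obs \<xi>) (base_of \<I> r x)) Z) \<in> measurable \<Omega> (count_space UNIV)"
    unfolding noise_space_def
  proof (rule measurable_best[OF \<open>finite Z\<close>])
    fix x assume "x \<in> Z"
    then have "base_of \<I> r x \<subseteq> N"
      using base_of_base(1)[of x] indep_subset assms by blast
    then show "(\<lambda>\<xi>. removal_score (obs \<xi>) (base_of \<I> r x)) \<in> borel_measurable (Pi\<^sub>M (Pow N) (\<lambda>_. D))"
      by (intro measurable_removal_score) auto
  qed
  from measurable_compose[OF this, of "base_of \<I> r" "count_space UNIV"]
  have base: "(\<lambda>\<xi>. base_of \<I> r (best (\<lambda>x. removal_score (obs \<xi>) (base_of \<I> r x)) Z)) \<in> measurable \<Omega> (count_space UNIV)"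
    by simp
  have score: "(\<lambda>\<xi>. neighbour_score X (obs \<xi>) S) \<in> borel_measurable \<Omega>" if "S \<subseteq> N" for S
    unfolding noise_space_def using that X by (intro measurable_neighbour_score) auto
  have "(\<lambda>\<xi>. decide \<I> r X (obs \<xi>) A Z) \<in> measurable \<Omega> (count_space UNIV)" if "A \<in> {A\<in>\<I>. card A = r}" for A
    unfolding decide_def
  proof (rule measurable_If[OF _ base])
    have A: "A \<subseteq> N" using that indep_subset by auto
    show "{\<xi>\<in>space \<Omega>. 2 * neighbour_score X (obs \<xi>) {} \<le> neighbour_score X (obs \<xi>) A} \<in> sets \<Omega>"
      by (rule borel_measurable_le[OF borel_measurable_times[OF borel_measurable_const score[OF empty_subsetI]] score[OF A]])
  qed simp
  moreover have "(\<lambda>\<xi>. greedy N \<I> X (obs \<xi>) r) \<in> measurable \<Omega> (count_space {A\<in>\<I>. card A = r})"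
    unfolding noise_space_def by (intro measurable_greedy) auto
  ultimately show ?thesis
    by (rule measurable_compose_countable') (use finite_indep in \<open>auto intro: countable_finite\<close>)
qed

text \<open>The drawn list is independent of the noise, so the success probability is a finite
  average over lists of noise probabilities. Lists that are not good count as failures, and (1 -
  a)(1 - b) \<ge> 1 - a - b.\<close>

lemma success_prob_ge:
  assumes XS: "X = sample_set N r" and "X \<noteq> {}"
    and good: "\<And>l. l \<in> lists X \<Longrightarrow> length l = r \<Longrightarrow> good l \<Longrightarrow>
      1 - a \<le> noise.prob {\<xi>\<in>space \<Omega>. approximation \<I> f \<beta> (outcome \<xi> (set l))}"
    and bad: "measure_pmf.prob (replicate_pmf r (pmf_of_set X)) {l. \<not> good l} \<le> b" and "a \<ge> 0"
  shows "1 - a - b \<le> success_prob (noisy_alg N r) N D \<I> f \<beta>"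
proof -
  define P where "P = replicate_pmf r (pmf_of_set X)"
  define L where "L = {l\<in>lists X. length l = r}"
  have L: "set_pmf P = L"
    using \<open>X \<noteq> {}\<close> finite_X by (auto simp: P_def L_def set_replicate_pmf)
  have "finite L"
    using finite_lists_length_eq[OF finite_X, of r] by (auto simp: L_def lists_eq_set)
  define E where "E l = {\<xi>\<in>space \<Omega>. approximation \<I> f \<beta> (outcome \<xi> (set l))}" for l
  have sets_E: "E l \<in> sets \<Omega>" if "l \<in> L" for l
  proof -
    have "set l \<subseteq> N" using that X by (auto simp: L_def)
    from measurable_sets[OF measurable_outcome[OF this], of "{S. approximation \<I> f \<beta> S}"]
    show ?thesis by (simp add: E_def vimage_def Int_def conj_commute)
  qed
  have prob_run: "measure_pmf.prob (run_noisy (noisy_alg N r) \<I> f \<xi>) {(S, q). approximation \<I> f \<beta> S} =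
      (\<Sum>l\<in>L. pmf P l * indicator (E l) \<xi>)" if \<xi>: "\<xi> \<in> space \<Omega>" for \<xi>
  proof -
    obtain q where q: "run_noisy (noisy_alg N r) \<I> f \<xi> = map_pmf (\<lambda>l. (outcome \<xi> (set l), q l)) P"
    proof -
      have "finite (base_of \<I> r x) \<and> card (base_of \<I> r x) = r" if "x \<in> X" for x
        using that base_of_base[of x] indep_finite X by auto
      moreover have "\<I> \<subseteq> Pow N" using indep_subset by auto
      ultimately show ?thesis
        using run_noisy_alg[of N \<I> r f \<xi>] finite_N finite_X \<open>X \<noteq> {}\<close> that
        unfolding XS[symmetric] P_def by blast
    qed
    let ?F = "{l. approximation \<I> f \<beta> (outcome \<xi> (set l))}"
    have "measure_pmf.prob (run_noisy (noisy_alg N r) \<I> f \<xi>) {(S, q). approximation \<I> f \<beta> S} = measure_pmf.prob P ?F"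
      by (simp add: q vimage_def)
    also have "\<dots> = measure_pmf.prob P (?F \<inter> L)"
      by (simp add: measure_Int_set_pmf L[symmetric])
    also have "\<dots> = (\<Sum>l\<in>?F \<inter> L. pmf P l)"
      using \<open>finite L\<close> by (intro measure_measure_pmf_finite) auto
    also have "\<dots> = (\<Sum>l\<in>L. pmf P l * indicator (E l) \<xi>)"
      using \<open>finite L\<close> \<xi> by (intro sum.mono_neutral_cong_left) (auto simp: E_def indicator_def)
    finally show ?thesis .
  qed
  have "success_prob (noisy_alg N r) N D \<I> f \<beta> = (LINT \<xi>|\<Omega>. (\<Sum>l\<in>L. pmf P l * indicator (E l) \<xi>))"
    unfolding success_prob_def by (intro Bochner_Integration.integral_cong prob_run) auto
  also have "\<dots> = (\<Sum>l\<in>L. LINT \<xi>|\<Omega>. pmf P l * indicator (E l) \<xi>)"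
    using sets_E by (intro Bochner_Integration.integral_sum integrable_mult_right) (auto simp: noise.emeasure_eq_measure)
  also have "\<dots> = (\<Sum>l\<in>L. pmf P l * noise.prob (E l))"
    using sets_E sets.sets_into_space by (intro sum.cong) (auto simp: Int_absorb2 E_def)
  also have "\<dots> \<ge> (\<Sum>l\<in>L \<inter> {l. good l}. pmf P l * (1 - a))"
  proof -
    have "(\<Sum>l\<in>L \<inter> {l. good l}. pmf P l * (1 - a)) \<le> (\<Sum>l\<in>L \<inter> {l. good l}. pmf P l * noise.prob (E l))"
      using good by (intro sum_mono mult_left_mono) (auto simp: E_def L_def)
    also have "\<dots> \<le> (\<Sum>l\<in>L. pmf P l * noise.prob (E l))"
      using \<open>finite L\<close> by (intro sum_mono2) auto
    finally show ?thesis .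
  qed
  finally have "(\<Sum>l\<in>L \<inter> {l. good l}. pmf P l * (1 - a)) \<le> success_prob (noisy_alg N r) N D \<I> f \<beta>" .
  moreover have "(\<Sum>l\<in>L \<inter> {l. good l}. pmf P l * (1 - a)) = measure_pmf.prob P {l. good l} * (1 - a)"
  proof -
    have "measure_pmf.prob P {l. good l} = measure_pmf.prob P (L \<inter> {l. good l})"
      by (metis L Int_commute measure_Int_set_pmf)
    also have "\<dots> = (\<Sum>l\<in>L \<inter> {l. good l}. pmf P l)"
      using \<open>finite L\<close> by (intro measure_measure_pmf_finite) auto
    finally show ?thesis by (simp add: sum_distrib_right)
  qed
  moreover have "measure_pmf.prob P {l. good l} = 1 - measure_pmf.prob P {l. \<not> good l}"
    using measure_pmf.prob_compl[of "{l. \<not> good l}" P] by (simp add: Compl_eq_Diff_UNIV[symmetric] Collect_neg_eq[symmetric])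
  ultimately have "(1 - measure_pmf.prob P {l. \<not> good l}) * (1 - a) \<le> success_prob (noisy_alg N r) N D \<I> f \<beta>"
    by simp
  moreover have "a * measure_pmf.prob P {l. \<not> good l} \<ge> 0"
    using \<open>a \<ge> 0\<close> by simp
  moreover have "measure_pmf.prob P {l. \<not> good l} \<le> b"
    using bad by (simp add: P_def)
  ultimately show ?thesis
    by (simp add: algebra_simps)
qed

lemma sets_removal_deviates:
  assumes "S \<subseteq> N"
  shows "{\<xi>\<in>space \<Omega>. removal_deviates \<kappa> t S \<xi>} \<in> sets \<Omega>"
proof -
  have "(\<lambda>\<xi>. removal_score (obs \<xi>) S) \<in> borel_measurable \<Omega>"
    unfolding noise_space_def using assms by (intro measurable_removal_score) auto
  then show ?thesis unfolding removal_deviates_def by measurable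
qed

text \<open>A union bound: one score for the empty set, \<open>r\<close> greedy steps with at most
  \<open>card N\<close> candidates each, and at most \<open>r\<close> removal scores. Off these
  events the deterministic guarantee applies.\<close>

lemma outcome_prob:
  assumes "r \<ge> 1000" and "opt > 0" and "\<kappa> > 0" "\<kappa>' > 0" and "X \<noteq> {}" and Z: "Z \<subseteq> N" "Z \<noteq> {}" "card Z \<le> r"
    and t: "t = (1/1000) * real (card X) * opt / (2 * real r)" "real r * opt \<le> t"
    and large: "(\<exists>z\<in>Z. 13/40 * opt \<le> f {z}) \<or> smoothed X f {} < 33/100 * real (card X) * opt"
    and \<beta>: "\<beta> \<le> 8/25"
    and p: "\<And>S. S \<in> \<I> \<Longrightarrow> noise.prob {\<xi>\<in>space \<Omega>. deviates \<kappa> (\<kappa> * t) S \<xi>} \<le> p"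
    and p': "\<And>S. S \<in> \<I> \<Longrightarrow> card S = r \<Longrightarrow>
      noise.prob {\<xi>\<in>space \<Omega>. removal_deviates \<kappa>' (\<kappa>' * ((1/1000) * real r * opt)) S \<xi>} \<le> p'"
  shows "1 - ((1 + real r * real (card N)) * p + real r * p') \<le>
    noise.prob {\<xi>\<in>space \<Omega>. approximation \<I> f \<beta> (outcome \<xi> Z)}"
proof -
  let ?E = "{\<xi>\<in>space \<Omega>. approximation \<I> f \<beta> (outcome \<xi> Z)}"
  let ?B0 = "{\<xi>\<in>space \<Omega>. deviates \<kappa> (\<kappa> * t) {} \<xi>}"
  let ?B1 = "\<lambda>i. {\<xi>\<in>space \<Omega>. greedy_deviates \<kappa> (\<kappa> * t) i \<xi>}"
  let ?B2 = "\<lambda>x. {\<xi>\<in>space \<Omega>. removal_deviates \<kappa>' (\<kappa>' * ((1/1000) * real r * opt)) (base_of \<I> r x) \<xi>}"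
  have finZ: "finite Z" using Z finite_N finite_subset by blast
  have base: "base_of \<I> r x \<in> \<I>" "card (base_of \<I> r x) = r" if "x \<in> Z" for x
    using base_of_base[of x] that Z by auto
  have empty: "{} \<in> \<I>" using matroid by (simp add: matroid_def)
  have sets0: "?B0 \<in> sets \<Omega>"
    unfolding noise_space_def using X by (intro sets_deviates) auto
  have sets1: "?B1 i \<in> sets \<Omega>" if "i < r" for i
    by (rule prob_greedy_step_deviates(1)[OF that p])
  have sets2: "?B2 x \<in> sets \<Omega>" if "x \<in> Z" for x
    by (rule sets_removal_deviates[OF indep_subset[OF base(1)[OF that]]])
  have setsE: "?E \<in> sets \<Omega>"
    using measurable_sets[OF measurable_outcome[OF Z(1)], of "{S. approximation \<I> f \<beta> S}"]
    by (simp add: vimage_def Int_def conj_commute)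
  have "space \<Omega> - ?E \<subseteq> ?B0 \<union> ((\<Union>i<r. ?B1 i) \<union> (\<Union>x\<in>Z. ?B2 x))"
  proof (rule ccontr)
    assume "\<not> ?thesis"
    then obtain \<xi> where \<xi>: "\<xi> \<in> space \<Omega>" "\<not> approximation \<I> f \<beta> (outcome \<xi> Z)"
      "\<not> deviates \<kappa> (\<kappa> * t) {} \<xi>" "\<And>i. i < r \<Longrightarrow> \<not> greedy_deviates \<kappa> (\<kappa> * t) i \<xi>"
      "\<And>x. x \<in> Z \<Longrightarrow> \<not> removal_deviates \<kappa>' (\<kappa>' * ((1/1000) * real r * opt)) (base_of \<I> r x) \<xi>"
      by blast
    have "8/25 * opt \<le> f (outcome \<xi> Z)"
      by (rule outcome_guarantee[OF \<open>r \<ge> 1000\<close> \<open>\<kappa> > 0\<close> \<open>\<kappa>' > 0\<close> \<open>X \<noteq> {}\<close> Z(1,2) t \<xi>(3,4,5) large])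
    moreover have "\<beta> * opt \<le> 8/25 * opt"
      using \<beta> opt_nonneg by (rule mult_right_mono)
    ultimately have "approximation \<I> f \<beta> (outcome \<xi> Z)"
      using outcome_indep[OF Z(1,2)] by (simp add: approximation_def opt_def)
    then show False using \<xi>(2) by simp
  qed
  then have "noise.prob (space \<Omega> - ?E) \<le> noise.prob (?B0 \<union> ((\<Union>i<r. ?B1 i) \<union> (\<Union>x\<in>Z. ?B2 x)))"
    using sets0 sets1 sets2 finZ by (intro noise.finite_measure_mono sets.Un sets.finite_UN) auto
  also have "\<dots> \<le> noise.prob ?B0 + noise.prob ((\<Union>i<r. ?B1 i) \<union> (\<Union>x\<in>Z. ?B2 x))"
    using sets0 sets1 sets2 finZ by (intro measure_Un_le sets.Un sets.finite_UN) auto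
  also have "noise.prob ((\<Union>i<r. ?B1 i) \<union> (\<Union>x\<in>Z. ?B2 x)) \<le> noise.prob (\<Union>i<r. ?B1 i) + noise.prob (\<Union>x\<in>Z. ?B2 x)"
    using sets1 sets2 finZ by (intro measure_Un_le sets.finite_UN) auto
  also have "noise.prob (\<Union>i<r. ?B1 i) \<le> (\<Sum>i<r. noise.prob (?B1 i))"
    using sets1 by (intro measure_UNION_le) auto
  also have "\<dots> \<le> (\<Sum>i<r. real (card N) * p)"
    by (intro sum_mono prob_greedy_step_deviates(2)[OF _ p]) auto
  also have "noise.prob (\<Union>x\<in>Z. ?B2 x) \<le> (\<Sum>x\<in>Z. noise.prob (?B2 x))"
    using sets2 finZ by (intro measure_UNION_le) auto
  also have "\<dots> \<le> (\<Sum>x\<in>Z. p')"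
    by (intro sum_mono p' base)
  also have "\<dots> \<le> real r * p'"
  proof -
    obtain z where "z \<in> Z" using Z by blast
    then have "p' \<ge> 0" using order_trans[OF measure_nonneg p'[OF base]] by blast
    then show ?thesis using Z(3) by (simp add: mult_right_mono)
  qed
  also have "noise.prob ?B0 \<le> p" by (rule p[OF empty])
  finally have "noise.prob (space \<Omega> - ?E) \<le> (1 + real r * real (card N)) * p + real r * p'"
    by (simp add: algebra_simps)
  then show ?thesis
    using noise.prob_compl[OF setsE] by simp
qed

lemma prob_misses_large:
  assumes "X \<noteq> {}" and "opt > 0" and "33/100 * real (card X) * opt \<le> smoothed X f {}"
  shows "measure_pmf.prob (replicate_pmf r (pmf_of_set X)) {l. \<not> (\<exists>z\<in>set l. 13/40 * opt \<le> f {z})} \<le> (199/200) ^ r"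
proof -
  define Y where "Y = {x\<in>X. 13/40 * opt \<le> f {x}}"
  have m: "real (card X) > 0" using assms finite_X by (simp add: card_gt_0_iff)
  \<comment> \<open>The gap 33/100 - 13/40 = 1/200 is the fraction of \<open>X\<close> that must be
    large.\<close>
  have "33/100 * real (card X) * opt \<le> real (card Y) * opt + real (card X) * (13/40 * opt)"
    using smoothed_empty_le[of "13/40 * opt"] assms by (simp add: Y_def)
  then have "(1/200 * real (card X)) * opt \<le> real (card Y) * opt"
    by (simp add: algebra_simps)
  then have Y: "1/200 * real (card X) \<le> real (card Y)"
    using \<open>opt > 0\<close> by simp
  have YX: "Y \<subseteq> X" by (auto simp: Y_def)
  have "X \<inter> - Y = X - Y" by auto
  then have "measure_pmf.prob (pmf_of_set X) (- Y) = real (card (X - Y)) / real (card X)"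
    using assms finite_X by (simp add: measure_pmf_of_set)
  also have "\<dots> = (real (card X) - real (card Y)) / real (card X)"
    using YX finite_X by (simp add: card_Diff_subset finite_subset of_nat_diff card_mono)
  also have "\<dots> \<le> 199/200"
    using m Y by (simp add: divide_le_eq)
  finally have "measure_pmf.prob (pmf_of_set X) (- Y) ^ r \<le> (199/200) ^ r"
    by (intro power_mono) auto
  moreover have "measure_pmf.prob (replicate_pmf r (pmf_of_set X)) {l. \<not> (\<exists>z\<in>set l. 13/40 * opt \<le> f {z})} =
      measure_pmf.prob (replicate_pmf r (pmf_of_set X)) {l. set l \<inter> Y = {}}"
  proof (rule measure_pmf.finite_measure_eq_AE)
    show "AE l in replicate_pmf r (pmf_of_set X). (l \<in> {l. \<not> (\<exists>z\<in>set l. 13/40 * opt \<le> f {z})}) = (l \<in> {l. set l \<inter> Y = {}})"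
      using assms finite_X by (auto simp: AE_measure_pmf_iff set_replicate_pmf Y_def)
  qed auto
  ultimately show ?thesis
    by (simp add: prob_replicate_pmf_avoid)
qed

end

subsection \<open>Choice of parameters\<close>

lemma sample_set_spec:
  assumes "finite N" "r * nat \<lfloor>sqrt (real (card N))\<rfloor> \<le> card N"
  shows "sample_set N r \<subseteq> N" and "card (sample_set N r) = r * nat \<lfloor>sqrt (real (card N))\<rfloor>"
proof -
  have "\<exists>X. X \<subseteq> N \<and> card X = r * nat \<lfloor>sqrt (real (card N))\<rfloor>"
    by (rule obtain_subset_with_card_n[OF assms(2)]) auto
  then have "sample_set N r \<subseteq> N \<and> card (sample_set N r) = r * nat \<lfloor>sqrt (real (card N))\<rfloor>"
    unfolding sample_set_def by (rule someI_ex)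
  then show "sample_set N r \<subseteq> N" and "card (sample_set N r) = r * nat \<lfloor>sqrt (real (card N))\<rfloor>"
    by auto
qed

context noisy_instance
begin

text \<open>Inserting \<open>t\<close> gives the exponent
  \<open>\<kappa>\<^sup>2 * s / (8000000 * r * B\<^sup>2)\<close>, which by the bounds on
  \<open>s\<close> and \<open>r\<close> grows at least like
  \<open>x powr (1/2 - 1/3 - 1/12)\<close>. Since 168 = 24 * 7, the tail at \<open>B\<close> is
  \<open>C / x ^ 7\<close>: one power pays for the terms of a score, two will pay for the union
  bound over candidates, and \<open>x ^ 4\<close> remains.\<close>

lemma prob_deviates_explicit:
  fixes C \<kappa>\<^sub>0 c :: real and s :: nat
  assumes "opt > 0" and "r > 0" and S: "S \<in> \<I>" and cardX: "card X = r * s"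
    and \<kappa>\<^sub>0: "\<kappa>\<^sub>0 > 0" "\<And>B. B \<ge> 1 \<Longrightarrow> \<kappa>\<^sub>0 \<le> clipped_mean D B"
    and tail: "\<And>B. B \<ge> 1 \<Longrightarrow> measure D {B<..} \<le> C / B ^ 168" and "C > 0"
    and x: "x = real (card N)" "x \<ge> 1" and s: "sqrt x / 2 \<le> real s" and r: "real r \<le> c * x powr (1/3)" and "c > 0"
  defines "\<kappa> \<equiv> clipped_mean D (x powr (1/24))"
    and "t \<equiv> (1/1000) * real (card X) * opt / (2 * real r)"
  shows "noise.prob {\<xi>\<in>space \<Omega>. deviates \<kappa> (\<kappa> * t) S \<xi>} \<le>
    2 * exp (- (\<kappa>\<^sub>0\<^sup>2 / (16000000 * c)) * x powr (1/12)) + C / x ^ 6"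
proof -
  define B where "B = x powr (1/24)"
  have B1: "B \<ge> 1" using x unfolding B_def by (intro ge_one_powr_ge_zero) auto
  have \<kappa>: "\<kappa>\<^sub>0 \<le> \<kappa>" "\<kappa> > 0" using \<kappa>\<^sub>0(2)[OF B1] \<kappa>\<^sub>0(1) by (auto simp: \<kappa>_def B_def)
  have s0: "real s > 0" using s x by (smt (verit) real_sqrt_ge_one half_gt_zero)
  have rs: "real (card X) = real r * real s" by (simp add: cardX)
  have t0: "t > 0" using assms(1,2) s0 by (simp add: t_def rs)
  have B2: "B\<^sup>2 = x powr (1/12)" using x by (simp add: B_def powr_powr[symmetric] power2_eq_square powr_add[symmetric])
  have B168: "B ^ 168 = x ^ 7"
  proof -
    have "B ^ 168 = B powr 168" using B1 by (simp add: powr_realpow)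
    also have "\<dots> = x powr 7" by (simp add: B_def powr_powr)
    also have "\<dots> = x ^ 7" using x by (simp add: powr_realpow)
    finally show ?thesis .
  qed
  have "noise.prob {\<xi>\<in>space \<Omega>. deviates \<kappa> (\<kappa> * t) S \<xi>} \<le>
      2 * exp (- 2 * (\<kappa> * t)\<^sup>2 / (real (card X) * (B * (2 * opt))\<^sup>2)) + real (card X) * measure D {B<..}"
    unfolding \<kappa>_def B_def[symmetric]
    using \<kappa>(2) B1 t0 by (intro prob_deviates S assms(1)) (auto simp: \<kappa>_def B_def)
  also have "- 2 * (\<kappa> * t)\<^sup>2 / (real (card X) * (B * (2 * opt))\<^sup>2) = - (\<kappa>\<^sup>2 * (real s / (real r * B\<^sup>2)) / 8000000)"
    using assms(1,2) s0 B1 by (simp add: t_def rs power2_eq_square field_simps)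
  also have "\<dots> \<le> - (\<kappa>\<^sub>0\<^sup>2 / (16000000 * c)) * x powr (1/12)"
  proof -
    have "x powr (1/12) / (2 * c) = (x powr (1/2) / 2) / (c * x powr (1/3) * x powr (1/12))"
    proof -
      have "x powr (1/2) = x powr (1/12) * (x powr (1/3) * x powr (1/12))"
        by (simp add: powr_add[symmetric])
      then show ?thesis using x \<open>c > 0\<close> by (simp add: field_simps)
    qed
    also have "\<dots> \<le> real s / (real r * B\<^sup>2)"
      unfolding B2 using s r \<open>r > 0\<close> x s0 \<open>c > 0\<close>
      by (intro frac_le mult_right_mono mult_pos_pos) (auto simp: powr_half_sqrt)
    finally have "x powr (1/12) / (2 * c) \<le> real s / (real r * B\<^sup>2)" .
    moreover have "\<kappa>\<^sub>0\<^sup>2 \<le> \<kappa>\<^sup>2" using \<kappa> \<kappa>\<^sub>0 by (intro power_mono) auto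
    ultimately have "\<kappa>\<^sub>0\<^sup>2 * (x powr (1/12) / (2 * c)) \<le> \<kappa>\<^sup>2 * (real s / (real r * B\<^sup>2))"
      using \<open>c > 0\<close> by (intro mult_mono) auto
    then have le: "- (\<kappa>\<^sup>2 * (real s / (real r * B\<^sup>2)) / 8000000) \<le> - (\<kappa>\<^sub>0\<^sup>2 * (x powr (1/12) / (2 * c)) / 8000000)"
      by (intro le_imp_neg_le divide_right_mono) auto
    have eq: "- (\<kappa>\<^sub>0\<^sup>2 / (16000000 * c)) * x powr (1/12) = - (\<kappa>\<^sub>0\<^sup>2 * (x powr (1/12) / (2 * c)) / 8000000)"
      using \<open>c > 0\<close> by (simp add: field_simps)
    show ?thesis unfolding eq by (rule le)
  qed
  also have "real (card X) * measure D {B<..} \<le> x * (C / x ^ 7)"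
  proof (intro mult_mono)
    show "real (card X) \<le> x" using card_mono[OF finite_N X] x by simp
    show "measure D {B<..} \<le> C / x ^ 7" using tail[OF B1] by (simp add: B168)
  qed (use x in auto)
  also have "x * (C / x ^ 7) = C / x ^ 6"
    using x by (simp add: field_simps eval_nat_numeral)
  finally show ?thesis by simp
qed

text \<open>A removal score of a base has just \<open>r\<close> terms, so the level is tied to
  \<open>r\<close> and the failure probability is small in \<open>r\<close>. Level
  \<open>r powr (1/4)\<close> leaves an exponent of order \<open>sqrt r\<close> and turns the tail
  bound into \<open>C / r ^ 42\<close>.\<close>

lemma prob_removal_deviates_explicit:
  fixes C \<kappa>\<^sub>0 :: real
  assumes "opt > 0" and "r > 0" and S: "S \<in> \<I>" "card S = r"
    and \<kappa>\<^sub>0: "\<kappa>\<^sub>0 > 0" "\<And>B. B \<ge> 1 \<Longrightarrow> \<kappa>\<^sub>0 \<le> clipped_mean D B"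
    and tail: "\<And>B. B \<ge> 1 \<Longrightarrow> measure D {B<..} \<le> C / B ^ 168"
  defines "\<kappa> \<equiv> clipped_mean D (real r powr (1/4))"
  shows "noise.prob {\<xi>\<in>space \<Omega>. removal_deviates \<kappa> (\<kappa> * ((1/1000) * real r * opt)) S \<xi>} \<le>
    2 * exp (- (\<kappa>\<^sub>0\<^sup>2 / 500000) * sqrt (real r)) + C / real r ^ 41"
proof -
  define B where "B = real r powr (1/4)"
  have r1: "real r \<ge> 1" using \<open>r > 0\<close> by simp
  have B1: "B \<ge> 1" using r1 unfolding B_def by (intro ge_one_powr_ge_zero) auto
  have \<kappa>: "\<kappa>\<^sub>0 \<le> \<kappa>" "\<kappa> > 0" using \<kappa>\<^sub>0(2)[OF B1] \<kappa>\<^sub>0(1) by (auto simp: \<kappa>_def B_def)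
  have B2: "B\<^sup>2 = sqrt (real r)"
    using r1 by (simp add: B_def power2_eq_square powr_add[symmetric] powr_half_sqrt)
  have B168: "B ^ 168 = real r ^ 42"
  proof -
    have "B ^ 168 = B powr 168" using B1 by (simp add: powr_realpow)
    also have "\<dots> = real r powr 42" by (simp add: B_def powr_powr)
    also have "\<dots> = real r ^ 42" using r1 by (simp add: powr_realpow)
    finally show ?thesis .
  qed
  let ?t = "\<kappa> * ((1/1000) * real r * opt)"
  have t0: "?t > 0" using \<kappa> assms(1,2) by simp
  have "noise.prob {\<xi>\<in>space \<Omega>. removal_deviates \<kappa> ?t S \<xi>} \<le>
      2 * exp (- 2 * ?t\<^sup>2 / (real r * (B * opt)\<^sup>2)) + real r * measure D {B<..}"
    unfolding \<kappa>_def B_def[symmetric]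
    using B1 t0 \<open>r > 0\<close> by (intro prob_removal_deviates S assms(1)) (auto simp: \<kappa>_def B_def)
  also have "- 2 * ?t\<^sup>2 / (real r * (B * opt)\<^sup>2) = - (\<kappa>\<^sup>2 * (real r / B\<^sup>2) / 500000)"
    using assms(1,2) B1 by (simp add: power2_eq_square field_simps)
  also have "\<dots> \<le> - (\<kappa>\<^sub>0\<^sup>2 / 500000) * sqrt (real r)"
  proof -
    have "\<kappa>\<^sub>0\<^sup>2 \<le> \<kappa>\<^sup>2" using \<kappa> \<kappa>\<^sub>0 by (intro power_mono) auto
    then have "\<kappa>\<^sub>0\<^sup>2 * sqrt (real r) \<le> \<kappa>\<^sup>2 * sqrt (real r)"
      by (intro mult_right_mono) auto
    then show ?thesis by (simp add: B2 real_div_sqrt)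
  qed
  also have "real r * measure D {B<..} \<le> real r * (C / real r ^ 42)"
    using tail[OF B1] by (intro mult_left_mono) (auto simp: B168)
  also have "real r * (C / real r ^ 42) = C / real r ^ 41"
    using r1 by (simp add: field_simps eval_nat_numeral)
  finally show ?thesis by simp
qed

lemma success_prob_bound:
  fixes C \<kappa>\<^sub>0 c :: real and s :: nat
  assumes XS: "X = sample_set N r" and cardX: "card X = r * s"
    and \<kappa>\<^sub>0: "\<kappa>\<^sub>0 > 0" "\<And>B. B \<ge> 1 \<Longrightarrow> \<kappa>\<^sub>0 \<le> clipped_mean D B"
    and tail: "\<And>B. B \<ge> 1 \<Longrightarrow> measure D {B<..} \<le> C / B ^ 168" and "C > 0"
    and x: "x = real (card N)" and s: "sqrt x / 2 \<le> real s" and r: "real r \<le> c * x powr (1/3)" and "c > 0"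
    and "r \<ge> 1000" and rs: "2000 * real r \<le> real s" and \<beta>: "\<beta> \<le> 8/25"
    and asym1: "4 * x\<^sup>2 * exp (- (\<kappa>\<^sub>0\<^sup>2 / (16000000 * c)) * x powr (1/12)) \<le> 1 / x ^ 4"
    and asym2: "2 * real r * exp (- (\<kappa>\<^sub>0\<^sup>2 / 500000) * sqrt (real r)) \<le> 1 / real r ^ 4"
    and asym3: "(199/200) ^ r \<le> 1 / real r ^ 4"
  shows "1 - (3 + 3 * C) / real r ^ 4 \<le> success_prob (noisy_alg N r) N D \<I> f \<beta>"
proof -
  have r0: "r > 0" "real r > 0" "real r \<ge> 1" using \<open>r \<ge> 1000\<close> by auto
  have s0: "s > 0" using rs r0 by (cases s) auto
  have X0: "X \<noteq> {}" using cardX r0 s0 by auto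
  have rX: "r \<le> card X" using s0 by (simp add: cardX)
  have rN: "real r \<le> x" using rX card_mono[OF finite_N X] x by simp
  have x1: "x \<ge> 1" using rN r0 by simp
  have small: "0 \<le> (3 + 3 * C) / real r ^ 4" using \<open>C > 0\<close> by simp
  have lists_sub: "set l \<subseteq> N" "set l \<noteq> {}" "card (set l) \<le> r" if "l \<in> lists X" "length l = r" for l
    using that X r0 card_length[of l] by auto
  show ?thesis
  proof (cases "opt = 0")
    case True
    \<comment> \<open>Accuracy is measured relative to \<open>opt\<close>, so concentration needs it
      positive. For \<open>opt = 0\<close> every independent set is optimal.\<close>
    have "1 - 0 - 0 \<le> success_prob (noisy_alg N r) N D \<I> f \<beta>"
    proof (rule success_prob_ge[OF XS X0, of "\<lambda>_. True"])
      fix l assume l: "l \<in> lists X" "length l = r"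
      have "approximation \<I> f \<beta> (outcome \<xi> (set l))" for \<xi>
        using outcome_indep[OF lists_sub(1,2)[OF l]] True objective_nonneg[OF objective] indep_subset
        by (simp add: approximation_def opt_def)
      then show "1 - 0 \<le> noise.prob {\<xi>\<in>space \<Omega>. approximation \<I> f \<beta> (outcome \<xi> (set l))}"
        by (simp add: noise.prob_space)
    qed simp_all
    then show ?thesis using small by simp
  next
    case False
    then have opt: "opt > 0" using opt_nonneg by simp
    define \<kappa> where "\<kappa> = clipped_mean D (x powr (1/24))"
    define \<kappa>' where "\<kappa>' = clipped_mean D (real r powr (1/4))"
    define t where "t = (1/1000) * real (card X) * opt / (2 * real r)"
    define p where "p = 2 * exp (- (\<kappa>\<^sub>0\<^sup>2 / (16000000 * c)) * x powr (1/12)) + C / x ^ 6"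
    define p' where "p' = 2 * exp (- (\<kappa>\<^sub>0\<^sup>2 / 500000) * sqrt (real r)) + C / real r ^ 41"
    define good where "good l \<longleftrightarrow> (\<exists>z\<in>set l. 13/40 * opt \<le> f {z}) \<or> smoothed X f {} < 33/100 * real (card X) * opt" for l
    have "x powr (1/24) \<ge> 1" "real r powr (1/4) \<ge> 1"
      using x1 r0 by (auto intro: ge_one_powr_ge_zero)
    then have \<kappa>: "\<kappa> > 0" "\<kappa>' > 0"
      using \<kappa>\<^sub>0 unfolding \<kappa>_def \<kappa>'_def by (auto intro: less_le_trans)
    have t: "real r * opt \<le> t"
    proof -
      have "2000 * real r * opt \<le> real s * opt"
        using rs opt by (intro mult_right_mono) auto
      then show ?thesis using r0 by (simp add: t_def cardX)
    qed
    define a where "a = (1 + real r * real (card N)) * p + real r * p'"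
    have p0: "p \<ge> 0" "p' \<ge> 0" using \<open>C > 0\<close> x1 by (auto simp: p_def p'_def)
    have "1 - a - (199/200) ^ r \<le> success_prob (noisy_alg N r) N D \<I> f \<beta>"
    proof (rule success_prob_ge[OF XS X0, of good])
      fix l assume l: "l \<in> lists X" "length l = r" "good l"
      show "1 - a \<le> noise.prob {\<xi>\<in>space \<Omega>. approximation \<I> f \<beta> (outcome \<xi> (set l))}"
        unfolding a_def
      proof (rule outcome_prob[OF \<open>r \<ge> 1000\<close> opt \<kappa> X0 lists_sub[OF l(1,2)] t_def t l(3)[unfolded good_def] \<beta>])
        show "noise.prob {\<xi>\<in>space \<Omega>. deviates \<kappa> (\<kappa> * t) S \<xi>} \<le> p" if "S \<in> \<I>" for S
          unfolding p_def \<kappa>_def t_def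
          by (rule prob_deviates_explicit[OF opt r0(1) that cardX \<kappa>\<^sub>0 tail \<open>C > 0\<close> x x1 s r \<open>c > 0\<close>])
        show "noise.prob {\<xi>\<in>space \<Omega>. removal_deviates \<kappa>' (\<kappa>' * ((1/1000) * real r * opt)) S \<xi>} \<le> p'"
          if "S \<in> \<I>" "card S = r" for S
          unfolding p'_def \<kappa>'_def
          by (rule prob_removal_deviates_explicit[OF opt r0(1) that \<kappa>\<^sub>0 tail])
      qed
    next
      show "measure_pmf.prob (replicate_pmf r (pmf_of_set X)) {l. \<not> good l} \<le> (199/200) ^ r"
      proof (cases "smoothed X f {} < 33/100 * real (card X) * opt")
        case False
        then have "33/100 * real (card X) * opt \<le> smoothed X f {}" by simp
        from prob_misses_large[OF X0 opt this] show ?thesis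
          using False by (simp add: good_def)
      qed (simp add: good_def)
      show "a \<ge> 0" using p0 by (simp add: a_def)
    qed
    moreover have "(1 + real r * real (card N)) * p \<le> (1 + 2 * C) / real r ^ 4"
    proof -
      have "real r * x \<le> x * x" "1 \<le> x * x"
        using rN x1 mult_mono[of 1 x 1 x] by (auto intro: mult_right_mono)
      then have "(1 + real r * real (card N)) * p \<le> (2 * x\<^sup>2) * p"
        using p0 x by (intro mult_right_mono) (auto simp: power2_eq_square)
      also have "\<dots> = 4 * x\<^sup>2 * exp (- (\<kappa>\<^sub>0\<^sup>2 / (16000000 * c)) * x powr (1/12)) + 2 * C / x ^ 4"
        using x1 by (simp add: p_def field_simps eval_nat_numeral)
      also have "\<dots> \<le> (1 + 2 * C) / x ^ 4"
        using asym1 by (simp add: add_divide_distrib)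
      also have "\<dots> \<le> (1 + 2 * C) / real r ^ 4"
        using rN r0 \<open>C > 0\<close> by (intro divide_left_mono power_mono mult_pos_pos) auto
      finally show ?thesis .
    qed
    moreover have "real r * p' \<le> (1 + C) / real r ^ 4"
    proof -
      have "real r * p' = 2 * real r * exp (- (\<kappa>\<^sub>0\<^sup>2 / 500000) * sqrt (real r)) + C / real r ^ 40"
        using r0 by (simp add: p'_def field_simps eval_nat_numeral)
      also have "\<dots> \<le> 1 / real r ^ 4 + C / real r ^ 4"
        using asym2 r0 \<open>C > 0\<close> by (intro add_mono divide_left_mono power_increasing) auto
      finally show ?thesis by (simp add: add_divide_distrib)
    qed
    moreover have "(3 + 3 * C) / real r ^ 4 = (1 + 2 * C) / real r ^ 4 + (1 + C) / real r ^ 4 + 1 / real r ^ 4"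
      by (simp add: add_divide_distrib[symmetric])
    ultimately show ?thesis using asym3 unfolding a_def by linarith
  qed
qed

end

text \<open>The greedy queries dominate: \<open>\<rho> * (x * m)\<close> is at most
  \<open>Q\<close>, and so are \<open>m\<close> and \<open>\<rho> * \<rho>\<close>, which gives
  \<open>4 * Q\<close>. The remaining factors are at least 1; for the logarithm this is where
  \<open>\<rho> \<ge> 3\<close> enters.\<close>

lemma query_budget:
  fixes x \<rho> \<epsilon> :: real
  assumes "\<rho> \<ge> 3" "x \<ge> 1" "0 < \<epsilon>" "\<epsilon> < 1" and q: "q \<le> \<rho> * (x * m) + 2 * m + \<rho> * \<rho>" and m: "0 \<le> m" "m \<le> \<rho> * sqrt x"
  shows "q \<le> 4 * (\<rho>\<^sup>2 * (ln \<rho>)\<^sup>2 * x powr (3/2) * (1 / \<epsilon>) * max \<rho> (ln x))"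
proof -
  define Q where "Q = \<rho>\<^sup>2 * x powr (3/2)"
  have x32: "x powr (3/2) = x * sqrt x"
    using assms(2) powr_add[of x 1 "1/2"] by (simp add: powr_half_sqrt)
  have x1: "x powr (3/2) \<ge> 1" using assms(2) by (intro ge_one_powr_ge_zero) auto
  have sx: "sqrt x \<le> x powr (3/2)"
    unfolding x32 using assms(2) mult_right_mono[of 1 x "sqrt x"] by simp
  have "\<rho> * (x * m) \<le> \<rho> * (x * (\<rho> * sqrt x))"
    using assms by (intro mult_left_mono) auto
  also have "\<dots> = Q" by (simp add: Q_def x32 power2_eq_square)
  finally have q1: "\<rho> * (x * m) \<le> Q" .
  have "\<rho> * sqrt x \<le> \<rho>\<^sup>2 * x powr (3/2)"
    using assms sx by (intro mult_mono) (auto simp: power2_eq_square)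
  then have q2: "m \<le> Q" using m by (simp add: Q_def)
  have q3: "\<rho> * \<rho> \<le> Q"
    using x1 mult_left_mono[of 1 "x powr (3/2)" "\<rho>\<^sup>2"] by (simp add: Q_def power2_eq_square)
  have "ln \<rho> \<ge> 1"
    using assms(1) exp_le by (subst ln_ge_iff) auto
  then have "1 \<le> (ln \<rho>)\<^sup>2" by (simp add: one_le_power)
  moreover have "1 \<le> 1 / \<epsilon>" using assms by simp
  moreover have "1 \<le> max \<rho> (ln x)" using assms(1) by simp
  ultimately have "1 * 1 * 1 \<le> (ln \<rho>)\<^sup>2 * (1 / \<epsilon>) * max \<rho> (ln x)"
    using \<open>0 < \<epsilon>\<close> by (intro mult_mono) auto
  then have "Q * 1 \<le> Q * ((ln \<rho>)\<^sup>2 * (1 / \<epsilon>) * max \<rho> (ln x))"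
    by (intro mult_left_mono) (auto simp: Q_def)
  then show ?thesis
    using q q1 q2 q3 by (simp add: Q_def mult_ac)
qed

theorem theorem5p1:
  fixes c\<^sub>1 c\<^sub>2 :: real
  assumes "c\<^sub>1 > 0" and "c\<^sub>2 > 0"
  shows "\<exists>alg :: real \<Rightarrow> 'a set \<Rightarrow> nat \<Rightarrow> 'a oracle_alg.
    \<forall>D. noise_distribution D \<longrightarrow>
      (\<exists>\<epsilon>\<^sub>0>0. \<exists>a>0. \<exists>b>0. \<exists>C>0. \<exists>C'>0. \<exists>K>0.
        \<forall>(\<epsilon>::real) (N :: 'a set) (n::nat) (r::nat) \<I> f.
          0 < \<epsilon> \<longrightarrow> \<epsilon> < \<epsilon>\<^sub>0 \<longrightarrow>
          finite N \<longrightarrow> card N = n \<longrightarrow>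
          a * exp ((1 / \<epsilon>) powr b) \<le> real n \<longrightarrow>
          c\<^sub>1 * ((1 / \<epsilon>) * ln (1 / \<epsilon>)) \<le> real r \<longrightarrow>
          real r \<le> c\<^sub>2 * real n powr (1/3) \<longrightarrow>
          matroid N \<I> \<longrightarrow> (\<forall>e\<in>N. {e} \<in> \<I>) \<longrightarrow> matroid_rank \<I> = r \<longrightarrow>
          objective_on N f \<longrightarrow>
            success_prob (alg \<epsilon> N r) N D \<I> f (1/2 * (1 - 1 / exp 1) - C * \<epsilon>) \<ge> 1 - C' * \<epsilon> ^ 4 \<and>
            (\<forall>\<xi>\<in>space (noise_space N D). \<forall>(S, q)\<in>set_pmf (run_noisy (alg \<epsilon> N r) \<I> f \<xi>).
               real q \<le> K * (real r ^ 2 * (ln (real r))\<^sup>2 * real n powr (3/2) * (1 / \<epsilon>)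
                              * max (real r) (ln (real n)))))"
proof (intro exI[of _ "\<lambda>_. noisy_alg"] allI impI)
  fix D assume noise: "noise_distribution D"
  then have D: "prob_space D" "sets D = sets borel" "integrable D (\<lambda>x. x)" "(LINT x|D. x) = 1"
    by (auto simp: noise_distribution_def)
  obtain C where C: "C > 0" "\<And>B. B \<ge> 1 \<Longrightarrow> measure D {B<..} \<le> C / B ^ 168"
    using noise_tail_bound[OF noise, of 168] by auto
  define \<kappa>\<^sub>0 where "\<kappa>\<^sub>0 = clipped_mean D 1"
  \<comment> \<open>The constants must be fixed before the instance, while the facts on
    \<open>clipped_mean\<close> live in a locale with a ground set; the empty one gives access to
    them.\<close>
  interpret empty: noise_model D "{} :: 'a set"
    by (rule noise_model.intro[OF D(1,2)]) simp
  have \<kappa>\<^sub>0: "\<kappa>\<^sub>0 > 0" "\<And>B. B \<ge> 1 \<Longrightarrow> \<kappa>\<^sub>0 \<le> clipped_mean D B"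
    unfolding \<kappa>\<^sub>0_def using empty.clipped_mean_pos[OF D(3,4)] empty.clipped_mean_mono[of 1] by auto
  define d where "d = \<kappa>\<^sub>0\<^sup>2 / (16000000 * c\<^sub>2)"
  define d' where "d' = \<kappa>\<^sub>0\<^sup>2 / 500000"
  have d: "d > 0" "d' > 0" using \<kappa>\<^sub>0(1) assms by (auto simp: d_def d'_def)
  \<comment> \<open>In this order: \<open>X\<close> fits into \<open>N\<close>; skipped terms are
    negligible; rounding keeps \<open>s\<close> above half the square root; the exponential survives
    the union bound.\<close>
  have "\<forall>\<^sub>F x in at_top. c\<^sub>2 * x powr (1/3) * sqrt x \<le> x \<and> 2000 * (c\<^sub>2 * x powr (1/3)) \<le> sqrt x - 1 \<and>
      sqrt x / 2 \<le> sqrt x - 1 \<and> 4 * x\<^sup>2 * exp (- d * x powr (1/12)) \<le> 1 / x ^ 4"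
    using d(1) assms(2) by (intro eventually_conj; real_asymp)
  then obtain x\<^sub>0 where x\<^sub>0: "\<And>x. x \<ge> x\<^sub>0 \<Longrightarrow> c\<^sub>2 * x powr (1/3) * sqrt x \<le> x \<and> 2000 * (c\<^sub>2 * x powr (1/3)) \<le> sqrt x - 1 \<and>
      sqrt x / 2 \<le> sqrt x - 1 \<and> 4 * x\<^sup>2 * exp (- d * x powr (1/12)) \<le> 1 / x ^ 4"
    unfolding eventually_at_top_linorder by blast
  have "\<forall>\<^sub>F \<rho> in at_top. 2 * \<rho> * exp (- d' * sqrt \<rho>) \<le> 1 / \<rho> ^ 4 \<and> (199/200) powr \<rho> \<le> 1 / \<rho> ^ 4"
    using d(2) by (intro eventually_conj; real_asymp)
  then obtain \<rho>\<^sub>0 where \<rho>\<^sub>0: "\<And>\<rho>. \<rho> \<ge> \<rho>\<^sub>0 \<Longrightarrow> 2 * \<rho> * exp (- d' * sqrt \<rho>) \<le> 1 / \<rho> ^ 4 \<and> (199/200) powr \<rho> \<le> 1 / \<rho> ^ 4"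
    unfolding eventually_at_top_linorder by blast
  \<comment> \<open>Lower bounds to be imposed on \<open>r\<close>: 1000 for the slack in the
    constants, \<open>\<rho>\<^sub>0\<close> for the asymptotics in \<open>r\<close>, and the last
    entry to force \<open>real n \<ge> x\<^sub>0\<close> through the upper bound on
    \<open>r\<close>.\<close>
  define R where "R = Max {1000, \<rho>\<^sub>0, c\<^sub>2 * (max x\<^sub>0 1) powr (1/3)}"
  have R: "R \<ge> 1000" "R \<ge> \<rho>\<^sub>0" "R \<ge> c\<^sub>2 * (max x\<^sub>0 1) powr (1/3)"
    by (auto simp: R_def)
  \<comment> \<open>The second entry makes \<open>c\<^sub>1 * ln (1 / \<epsilon>)\<close> at least
    1, hence \<open>1 / \<epsilon> \<le> real r\<close>; the first then gives
    \<open>R < real r\<close>.\<close>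
  define \<epsilon>\<^sub>0 where "\<epsilon>\<^sub>0 = min (1 / R) (exp (- (1 / c\<^sub>1)))"
  have main: "1 - (3 + 3 * C) * \<epsilon> ^ 4 \<le> success_prob (noisy_alg N r) N D \<I> f (1/2 * (1 - 1 / exp 1) - 1 * \<epsilon>) \<and>
      (\<forall>\<xi>\<in>space (noise_space N D). \<forall>(S, q)\<in>set_pmf (run_noisy (noisy_alg N r) \<I> f \<xi>).
         real q \<le> 4 * (real r ^ 2 * (ln (real r))\<^sup>2 * real n powr (3/2) * (1 / \<epsilon>) * max (real r) (ln (real n))))"
    if \<epsilon>: "0 < \<epsilon>" "\<epsilon> < \<epsilon>\<^sub>0" and N: "finite N" "card N = n"
      and r_lower: "c\<^sub>1 * ((1 / \<epsilon>) * ln (1 / \<epsilon>)) \<le> real r" and r_upper: "real r \<le> c\<^sub>2 * real n powr (1/3)"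
      and M: "matroid N \<I>" "\<forall>e\<in>N. {e} \<in> \<I>" "matroid_rank \<I> = r" and f: "objective_on N f"
    for \<epsilon> :: real and N :: "'a set" and n r :: nat and \<I> f
  proof -
    have "1 / c\<^sub>1 \<le> ln (1 / \<epsilon>)"
    proof -
      have "ln \<epsilon> \<le> ln (exp (- (1 / c\<^sub>1)))"
        using \<epsilon> by (intro ln_mono) (auto simp: \<epsilon>\<^sub>0_def)
      then show ?thesis using \<epsilon> by (simp add: ln_div)
    qed
    then have "1 / \<epsilon> * 1 \<le> 1 / \<epsilon> * (c\<^sub>1 * ln (1 / \<epsilon>))"
      using \<epsilon> assms by (intro mult_left_mono) (auto simp: field_simps)
    then have r_ge: "1 / \<epsilon> \<le> real r" using r_lower by (simp add: mult_ac)
    have "R < 1 / \<epsilon>"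
      using \<epsilon> R(1) by (simp add: \<epsilon>\<^sub>0_def field_simps)
    then have rR: "R < real r" using r_ge by simp
    have r1000: "r \<ge> 1000" using rR R(1) by simp
    have nx: "real n \<ge> max x\<^sub>0 1"
    proof (rule ccontr)
      assume "\<not> real n \<ge> max x\<^sub>0 1"
      then have "c\<^sub>2 * real n powr (1/3) \<le> c\<^sub>2 * (max x\<^sub>0 1) powr (1/3)"
        using assms by (intro mult_left_mono powr_mono2) auto
      then show False using r_upper rR R(3) by linarith
    qed
    then have n1: "real n \<ge> 1" and n0: "real n \<ge> x\<^sub>0" by auto
    define s where "s = nat \<lfloor>sqrt (real n)\<rfloor>"
    have s: "sqrt (real n) - 1 \<le> real s" "real s \<le> sqrt (real n)"
    proof -
      have "real s = of_int \<lfloor>sqrt (real n)\<rfloor>" by (simp add: s_def)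
      then show "sqrt (real n) - 1 \<le> real s" "real s \<le> sqrt (real n)" by linarith+
    qed
    define X where "X = sample_set N r"
    have "real (r * s) \<le> real n"
    proof -
      have "real r * real s \<le> (c\<^sub>2 * real n powr (1/3)) * sqrt (real n)"
        using r_upper s by (intro mult_mono) auto
      also have "\<dots> \<le> real n" using x\<^sub>0[OF n0] by blast
      finally show ?thesis by simp
    qed
    then have "r * s \<le> card N" using N by linarith
    then have Xs: "X \<subseteq> N" "card X = r * s"
      using sample_set_spec[OF N(1), of r] N(2) by (auto simp: X_def s_def)
    interpret noisy_instance D N \<I> f r X
      by (rule noisy_instance.intro[OF noise_model.intro[OF D(1,2) N(1)] noisy_instance_axioms.intro[OF M f Xs(1)]])
    have s_large: "2000 * real r \<le> real s" "sqrt (real n) / 2 \<le> real s"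
      using x\<^sub>0[OF n0] s(1) r_upper by auto
    \<comment> \<open>This puts \<open>1/2 * (1 - 1 / exp 1)\<close> below 0.317, so the achieved
      ratio 8/25 exceeds the target for every positive \<open>\<epsilon>\<close>.\<close>
    have "exp 1 \<le> (272/100 :: real)" using e_less_272 by simp
    then have "100/272 \<le> 1 / (exp 1 :: real)" by (simp add: field_simps)
    then have \<beta>: "1/2 * (1 - 1 / exp 1) - 1 * \<epsilon> \<le> 8/25"
    proof -
      have "1/2 * (1 - u) - 1 * \<epsilon> \<le> 8/25" if "100/272 \<le> u" for u
        using that \<epsilon>(1) by (simp add: field_simps)
      then show ?thesis using \<open>100/272 \<le> 1 / exp 1\<close> by blast
    qed
    have asym3: "(199/200) ^ r \<le> 1 / real r ^ 4"
      using \<rho>\<^sub>0[of "real r"] rR R(2) by (simp add: powr_realpow)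
    have "1 - (3 + 3 * C) / real r ^ 4 \<le> success_prob (noisy_alg N r) N D \<I> f (1/2 * (1 - 1 / exp 1) - 1 * \<epsilon>)"
      using x\<^sub>0[OF n0] \<rho>\<^sub>0[of "real r"] rR R(2) N(2) s_large r_upper
      by (intro success_prob_bound[OF X_def Xs(2) \<kappa>\<^sub>0 C(2,1) refl _ _ assms(2) r1000 _ \<beta> _ _ asym3])
        (auto simp: d_def d'_def)
    moreover have "(3 + 3 * C) / real r ^ 4 \<le> (3 + 3 * C) * \<epsilon> ^ 4"
    proof -
      have "1 / real r \<le> \<epsilon>" using r_ge \<epsilon> r1000 by (simp add: field_simps)
      then have "(1 / real r) ^ 4 \<le> \<epsilon> ^ 4" by (intro power_mono) auto
      then have "(3 + 3 * C) * (1 / real r) ^ 4 \<le> (3 + 3 * C) * \<epsilon> ^ 4"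
        using C(1) by (intro mult_left_mono) auto
      then show ?thesis by (simp add: power_one_over)
    qed
    moreover have "real q \<le> 4 * (real r ^ 2 * (ln (real r))\<^sup>2 * real n powr (3/2) * (1 / \<epsilon>) * max (real r) (ln (real n)))"
      if Sq: "(S, q) \<in> set_pmf (run_noisy (noisy_alg N r) \<I> f \<xi>)" for \<xi> S q
    proof -
      have X0: "X \<noteq> {}" using Xs(2) r1000 s_large by auto
      have base: "finite (base_of \<I> r x) \<and> card (base_of \<I> r x) = r" if "x \<in> X" for x
        using that base_of_base[of x] indep_finite Xs by auto
      have "\<I> \<subseteq> Pow N" using indep_subset by auto
      from run_noisy_alg[OF N(1) this, of r f \<xi>, folded X_def, OF finite_X X0 base]
      have "q \<le> r * (card N * card X) + 2 * card X + r * r"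
        using Sq by auto
      then have "real q \<le> real (r * (card N * card X) + 2 * card X + r * r)"
        by (simp only: of_nat_le_iff)
      then have "real q \<le> real r * (real n * real (card X)) + 2 * real (card X) + real r * real r"
        using N(2) by simp
      moreover have "real (card X) \<le> real r * sqrt (real n)"
        using Xs(2) s(2) by (simp add: mult_left_mono)
      moreover have "\<epsilon> < 1"
        using \<epsilon> R(1) by (simp add: \<epsilon>\<^sub>0_def) (smt (verit) divide_le_eq_1)
      ultimately show ?thesis
        using \<epsilon>(1) n1 r1000 by (intro query_budget) auto
    qed
    ultimately show ?thesis by fastforce
  qed
  have "\<epsilon>\<^sub>0 > 0" using R(1) by (simp add: \<epsilon>\<^sub>0_def)
  moreover have "3 + 3 * C > 0" using C(1) by simp
  ultimately show "\<exists>\<epsilon>\<^sub>0>0. \<exists>a>0. \<exists>b>0. \<exists>C>0. \<exists>C'>0. \<exists>K>0.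
        \<forall>(\<epsilon>::real) (N :: 'a set) (n::nat) (r::nat) \<I> f.
          0 < \<epsilon> \<longrightarrow> \<epsilon> < \<epsilon>\<^sub>0 \<longrightarrow>
          finite N \<longrightarrow> card N = n \<longrightarrow>
          a * exp ((1 / \<epsilon>) powr b) \<le> real n \<longrightarrow>
          c\<^sub>1 * ((1 / \<epsilon>) * ln (1 / \<epsilon>)) \<le> real r \<longrightarrow>
          real r \<le> c\<^sub>2 * real n powr (1/3) \<longrightarrow>
          matroid N \<I> \<longrightarrow> (\<forall>e\<in>N. {e} \<in> \<I>) \<longrightarrow> matroid_rank \<I> = r \<longrightarrow>
          objective_on N f \<longrightarrow>
            success_prob (noisy_alg N r) N D \<I> f (1/2 * (1 - 1 / exp 1) - C * \<epsilon>) \<ge> 1 - C' * \<epsilon> ^ 4 \<and>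
            (\<forall>\<xi>\<in>space (noise_space N D). \<forall>(S, q)\<in>set_pmf (run_noisy (noisy_alg N r) \<I> f \<xi>).
               real q \<le> K * (real r ^ 2 * (ln (real r))\<^sup>2 * real n powr (3/2) * (1 / \<epsilon>)
                              * max (real r) (ln (real n))))"
    using main
    by (intro exI[of _ \<epsilon>\<^sub>0] exI[of _ "1::real"] exI[of _ "3 + 3 * C"] exI[of _ "4::real"] conjI allI impI) auto
qed

end
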